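(* The exponential mapping $\operatorname{Exp}: N \to \widetilde{\mathcal A}$ is a real-analytic diffeomorphism. The inverse mapping $\operatorname{Exp}^{-1}: \widetilde{\mathcal A} \to N$, $(x,y,z)\mapsto(\psi,c,t)$, is given by the following formulas: \begin{align*} &z = 0 \ \Rightarrow\ \psi = \operatorname{artanh}\frac yx, \quad c = 0, \quad t = \sqrt{x^2-y^2},\\ &z \neq 0 \ \Rightarrow\ \psi = \operatorname{artanh}\frac yx - p, \quad c = (\operatorname{sgn} z)\sqrt{\frac{\sinh 2p - 2p}{2z}}, \quad t = \frac{2p}{c}, \end{align*} where $p = \beta\left(\frac{z}{x^2-y^2}\right)$, and $\beta: \left(-\frac14,\frac14\right)\to\mathbb R$ is the inverse function to the diffeomorphism $$\alpha:\mathbb R\to\left(-\tfrac14,\tfrac14\right),\qquad \alpha(p)=\frac{\sinh 2p-2p}{8\sinh^2 p}.$$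
   Context: $N=\mathbb R^2_{\psi,c}\times(0,+\infty)_t$ and $\widetilde{\mathcal A}=\{(x,y,z)\in\mathbb R^3 \mid -x^2+y^2+4|z|<0,\ x>0\}$. The exponential mapping $\operatorname{Exp}(\psi,c,t)=(x,y,z)$ (which parametrizes the strictly normal arclength-parametrized extremal trajectories starting at the origin of the left-invariant sub-Lorentzian problem on the Heisenberg group) is given explicitly by: if $c=0$: $x=t\cosh\psi$, $y=t\sinh\psi$, $z=0$; if $c\ne0$: $x=\dfrac{\sinh(\psi+ct)-\sinh\psi}{c}$, $y=\dfrac{\cosh(\psi+ct)-\cosh\psi}{c}$, $z=\dfrac{\sinh(ct)-ct}{2c^2}$. The function $\alpha$ is extended to $p=0$ by continuity: $\alpha(0)=0$. *)

theory Defs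
  imports "HOL-Analysis.Analysis"
begin

text \<open>
  Real-analyticity in several variables: around every point \<open>a\<close> of \<open>S\<close>, \<open>f\<close> is the sum of an
  unconditionally convergent power series in the coordinates of \<open>x - a\<close>.  Multi-indices are the
  extensional functions from \<open>Basis\<close> to the naturals.
\<close>

definition real_analytic_on ::
    "('a::euclidean_space \<Rightarrow> 'b::euclidean_space) \<Rightarrow> 'a set \<Rightarrow> bool"  (infix "real'_analytic'_on" 50)
  where "f real_analytic_on S \<longleftrightarrow>
    (\<forall>a\<in>S. \<exists>u r. r > 0 \<and>
      (\<forall>x\<in>ball a r.
        ((\<lambda>m. (\<Prod>b\<in>Basis. ((x - a) \<bullet> b) ^ m b) *\<^sub>R u m) has_sum f x) (Basis \<rightarrow>\<^sub>E (UNIV :: nat set))))"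

definition real_analytic_diffeo ::
    "('a::euclidean_space \<Rightarrow> 'b::euclidean_space) \<Rightarrow> 'a set \<Rightarrow> 'b set \<Rightarrow> bool"
  where "real_analytic_diffeo f S T \<longleftrightarrow>
    open S \<and> open T \<and> bij_betw f S T \<and> f real_analytic_on S \<and> inv_into S f real_analytic_on T"

definition N :: "(real \<times> real \<times> real) set"
  where "N = {(\<psi>, c, t). t > 0}"

definition A_tilde :: "(real \<times> real \<times> real) set"
  where "A_tilde = {(x, y, z). - x\<^sup>2 + y\<^sup>2 + 4 * \<bar>z\<bar> < 0 \<and> x > 0}"

definition Exp :: "real \<times> real \<times> real \<Rightarrow> real \<times> real \<times> real"
  where "Exp = (\<lambda>(\<psi>, c, t).
    if c = 0 then (t * cosh \<psi>, t * sinh \<psi>, 0)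
    else ((sinh (\<psi> + c * t) - sinh \<psi>) / c,
          (cosh (\<psi> + c * t) - cosh \<psi>) / c,
          (sinh (c * t) - c * t) / (2 * c\<^sup>2)))"

definition alpha :: "real \<Rightarrow> real"
  where "alpha p = (if p = 0 then 0 else (sinh (2 * p) - 2 * p) / (8 * (sinh p)\<^sup>2))"

text \<open>Only the values of \<open>beta\<close> on \<open>{-1/4<..<1/4}\<close>, the range of \<open>alpha\<close>, are meaningful.\<close>

definition beta :: "real \<Rightarrow> real"
  where "beta = inv_into UNIV alpha"

end

(*
  With q = ct/2 and S(q) = sinh q / q the exponential mapping reads
    x = t S(q) cosh (psi + q),  y = t S(q) sinh (psi + q),  z = t^2 (sinh 2q - 2q) / (8 q^2),
  so x^2 - y^2 = t^2 S(q)^2, y/x = tanh (psi + q) and z / (x^2 - y^2) = alpha q.  Since alpha is an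
  increasing bijection onto (-1/4, 1/4), these relations determine q, then t, then psi and c.

  Analyticity: power series with absolutely convergent majorants on a polydisc are closed under
  sums, products and composition with functions of one real variable that extend holomorphically.
  The one-variable functions extend holomorphically (removable singularities at 0), and beta does
  because alpha' > 0 makes the holomorphic extension of alpha locally invertible.
*)
theory Submission
  imports Defs "HOL-Complex_Analysis.Complex_Analysis" "HOL-Real_Asymp.Real_Asymp"
begin

section \<open>Majorized power series\<close>

text \<open>The obstacle is the several-variable notion of analyticity: it asks for an
  unconditionally convergent series over multi-indices, so composition has to be carried out by
  rearranging such series. The device is the weighted l1 norm of the coefficients on a closed
  polydisc. It is submultiplicative and dominates the sup norm, so a one-variable power series can
  be applied to a function whose norm lies inside the disc of convergence. Shrinking the polydisc
  always achieves this, because the norm of a series without constant term tends to 0 with the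
  radius. The stated formulas change form at c = 0 and at z = 0, which hides analyticity exactly
  there. The proof uses uniform formulas instead; on the inverse side c = 2p/t becomes 2 sinh p /
  sqrt(x^2 - y^2). Since the inverse is explicit, an inverse function argument occurs only in one
  variable, for alpha.\<close>

abbreviation multi_indices :: "('a::euclidean_space \<Rightarrow> nat) set"
  where "multi_indices \<equiv> Basis \<rightarrow>\<^sub>E UNIV"

definition mdeg :: "('a::euclidean_space \<Rightarrow> nat) \<Rightarrow> nat"
  where "mdeg m = (\<Sum>b\<in>Basis. m b)"

definition monomial :: "'a::euclidean_space \<Rightarrow> ('a \<Rightarrow> nat) \<Rightarrow> real"
  where "monomial x m = (\<Prod>b\<in>Basis. (x \<bullet> b) ^ m b)"

definition polydisc :: "real \<Rightarrow> 'a::euclidean_space set"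
  where "polydisc \<rho> = {x. \<forall>b\<in>Basis. \<bar>x \<bullet> b\<bar> \<le> \<rho>}"

text \<open>The bound \<open>M\<close> is a parameter because composition compares it with a radius
  of convergence. It is an upper bound rather than the exact norm, so that sums and products of
  functions simply add and multiply their bounds.\<close>

definition majorized :: "('a::euclidean_space \<Rightarrow> real) \<Rightarrow> real \<Rightarrow> real \<Rightarrow> bool"
  where "majorized f \<rho> M \<longleftrightarrow> (\<exists>u.
    (\<lambda>m. \<bar>u m\<bar> * \<rho> ^ mdeg m) summable_on multi_indices \<and>
    (\<Sum>\<^sub>\<infinity>m\<in>multi_indices. \<bar>u m\<bar> * \<rho> ^ mdeg m) \<le> M \<and>
    (\<forall>x\<in>polydisc \<rho>. ((\<lambda>m. u m * monomial x m) has_sum f x) multi_indices))"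

lemma abs_monomial_le:
  assumes "x \<in> polydisc \<rho>"
  shows "\<bar>monomial x m\<bar> \<le> \<rho> ^ mdeg m"
proof -
  have "\<bar>monomial x m\<bar> = (\<Prod>b\<in>Basis. \<bar>x \<bullet> b\<bar> ^ m b)"
    by (simp add: monomial_def abs_prod power_abs)
  also have "\<dots> \<le> (\<Prod>b\<in>Basis. \<rho> ^ m b)"
    using assms by (intro prod_mono conjI power_mono) (auto simp: polydisc_def)
  also have "\<dots> = \<rho> ^ mdeg m"
    by (simp add: mdeg_def power_sum)
  finally show ?thesis .
qed

text \<open>For reals, summability over a set is absolute summability. Hence the iterated sum of
  absolute values makes the product family summable, and its value is the iterated sum.\<close>

lemma has_sum_product_real:
  fixes a :: "'i \<Rightarrow> real" and b :: "'j \<Rightarrow> real"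
  assumes a: "(a has_sum s) I" and b: "(b has_sum t) J"
  shows "((\<lambda>(i, j). a i * b j) has_sum s * t) (I \<times> J)"
proof (rule has_sum_SigmaI)
  show "((\<lambda>j. case (i, j) of (i, j) \<Rightarrow> a i * b j) has_sum a i * t) J" for i
    using has_sum_cmult_right[OF b, of "a i"] by simp
  show "((\<lambda>i. a i * t) has_sum s * t) I"
    by (rule has_sum_cmult_left[OF a])
  have absa: "(\<lambda>i. \<bar>a i\<bar>) summable_on I" and absb: "(\<lambda>j. \<bar>b j\<bar>) summable_on J"
    using a b summable_on_iff_abs_summable_on_real[of a I] summable_on_iff_abs_summable_on_real[of b J]
    by (auto dest: has_sum_imp_summable)
  have "(\<lambda>(i, j). \<bar>a i\<bar> * \<bar>b j\<bar>) summable_on (I \<times> J)"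
  proof (rule summable_on_SigmaI)
    show "((\<lambda>j. case (i, j) of (i, j) \<Rightarrow> \<bar>a i\<bar> * \<bar>b j\<bar>) has_sum \<bar>a i\<bar> * (\<Sum>\<^sub>\<infinity>j\<in>J. \<bar>b j\<bar>)) J" for i
      using has_sum_cmult_right[OF has_sum_infsum[OF absb], of "\<bar>a i\<bar>"] by simp
    show "(\<lambda>i. \<bar>a i\<bar> * (\<Sum>\<^sub>\<infinity>j\<in>J. \<bar>b j\<bar>)) summable_on I"
      by (rule summable_on_cmult_left[OF absa])
  qed auto
  moreover have "(\<lambda>(i, j). \<bar>a i\<bar> * \<bar>b j\<bar>) = (\<lambda>p. \<bar>case p of (i, j) \<Rightarrow> a i * b j\<bar>)"
    by (auto simp: abs_mult)
  ultimately have "(\<lambda>p. norm (case p of (i, j) \<Rightarrow> a i * b j)) summable_on (I \<times> J)"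
    by simp
  then show "(\<lambda>(i, j). a i * b j) summable_on (I \<times> J)"
    by (rule abs_summable_summable)
qed

text \<open>Terms indexed by an arbitrary set may be collected according to their multi-index; all
  closure properties with infinitely many or repeated multi-indices are instances of this.\<close>

lemma majorizedI_regroup:
  fixes f :: "'a::euclidean_space \<Rightarrow> real"
  assumes \<rho>: "\<rho> > 0"
    and d: "\<And>i. i \<in> I \<Longrightarrow> d i \<in> multi_indices"
    and S: "((\<lambda>i. \<bar>c i\<bar> * \<rho> ^ mdeg (d i)) has_sum s) I" "s \<le> M"
    and f: "\<And>x. x \<in> polydisc \<rho> \<Longrightarrow> ((\<lambda>i. c i * monomial x (d i)) has_sum f x) I"
  shows "majorized f \<rho> M"
proof -
  define F where "F m = {i \<in> I. d i = m}" for m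
  define u where "u m = infsum c (F m)" for m
  define v where "v m = (\<Sum>\<^sub>\<infinity>i\<in>F m. \<bar>c i\<bar>)" for m
  have bij: "bij_betw snd (Sigma multi_indices F) I"
    using d by (auto simp: bij_betw_def inj_on_def F_def image_iff)
  have S': "((\<lambda>(m, i). \<bar>c i\<bar> * \<rho> ^ mdeg m) has_sum s) (Sigma multi_indices F)"
  proof -
    have "((\<lambda>p. \<bar>c (snd p)\<bar> * \<rho> ^ mdeg (d (snd p))) has_sum s) (Sigma multi_indices F)"
      using has_sum_reindex_bij_betw[OF bij, of "\<lambda>i. \<bar>c i\<bar> * \<rho> ^ mdeg (d i)" s] S(1) by simp
    then show ?thesis
      by (rule has_sum_cong[THEN iffD1, rotated]) (auto simp: F_def)
  qed
  \<comment> \<open>On a single fibre the weight \<open>\<rho> ^ mdeg m\<close> is a nonzero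
    constant and can be cancelled.\<close>
  have abs: "(\<lambda>i. \<bar>c i\<bar>) summable_on F m" if "m \<in> multi_indices" for m
  proof -
    have "(\<lambda>i. \<bar>c i\<bar> * \<rho> ^ mdeg m) summable_on F m"
      by (rule summable_on_SigmaD1[OF has_sum_imp_summable[OF S'] that])
    then show ?thesis
      using \<rho> by (simp add: summable_on_cmult_left')
  qed
  have hu: "(c has_sum u m) (F m)" if "m \<in> multi_indices" for m
    unfolding u_def using abs[OF that] summable_on_iff_abs_summable_on_real[of c "F m"] by simp
  have uv: "\<bar>u m\<bar> \<le> v m" if "m \<in> multi_indices" for m
    using norm_infsum_le[OF hu[OF that], of "\<lambda>i. \<bar>c i\<bar>" "v m"] has_sum_infsum[OF abs[OF that]]
    by (simp add: v_def)
  have V: "((\<lambda>m. v m * \<rho> ^ mdeg m) has_sum s) multi_indices"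
  proof (rule has_sum_SigmaD[OF S'])
    fix m :: "'a \<Rightarrow> nat" assume "m \<in> multi_indices"
    then show "((\<lambda>i. case (m, i) of (m, i) \<Rightarrow> \<bar>c i\<bar> * \<rho> ^ mdeg m) has_sum v m * \<rho> ^ mdeg m) (F m)"
      using has_sum_cmult_left[OF has_sum_infsum[OF abs]] by (simp add: v_def)
  qed
  \<comment> \<open>Collecting terms can only lower the norm: this is the triangle inequality on
    each fibre.\<close>
  have le: "\<bar>u m\<bar> * \<rho> ^ mdeg m \<le> v m * \<rho> ^ mdeg m" if "m \<in> multi_indices" for m
    using uv[OF that] \<rho> by (simp add: mult_right_mono)
  have sm: "(\<lambda>m. \<bar>u m\<bar> * \<rho> ^ mdeg m) summable_on multi_indices"
    by (rule summable_on_comparison_test[OF has_sum_imp_summable[OF V] le]) (use \<rho> in auto)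
  have "(\<Sum>\<^sub>\<infinity>m\<in>multi_indices. \<bar>u m\<bar> * \<rho> ^ mdeg m) \<le> s"
    using infsum_mono[OF sm has_sum_imp_summable[OF V] le] infsumI[OF V] by simp
  moreover have "((\<lambda>m. u m * monomial x m) has_sum f x) multi_indices" if x: "x \<in> polydisc \<rho>" for x
  proof -
    have "((\<lambda>p. c (snd p) * monomial x (d (snd p))) has_sum f x) (Sigma multi_indices F)"
      using has_sum_reindex_bij_betw[OF bij, of "\<lambda>i. c i * monomial x (d i)" "f x"] f[OF x] by simp
    then have "((\<lambda>(m, i). c i * monomial x m) has_sum f x) (Sigma multi_indices F)"
      by (rule has_sum_cong[THEN iffD1, rotated]) (auto simp: F_def)
    then show ?thesis
    proof (rule has_sum_SigmaD)
      fix m :: "'a \<Rightarrow> nat" assume "m \<in> multi_indices"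
      then show "((\<lambda>i. case (m, i) of (m, i) \<Rightarrow> c i * monomial x m) has_sum u m * monomial x m) (F m)"
        using has_sum_cmult_left[OF hu] by simp
    qed
  qed
  ultimately show ?thesis
    unfolding majorized_def using sm S(2) by (intro exI[of _ u]) auto
qed

lemma majorizedE:
  assumes "majorized f \<rho> M"
  obtains u s where "((\<lambda>m. \<bar>u m\<bar> * \<rho> ^ mdeg m) has_sum s) multi_indices" "s \<le> M"
    "\<forall>x\<in>polydisc \<rho>. ((\<lambda>m. u m * monomial x m) has_sum f x) multi_indices"
proof -
  obtain u where u: "(\<lambda>m. \<bar>u m\<bar> * \<rho> ^ mdeg m) summable_on multi_indices"
    "(\<Sum>\<^sub>\<infinity>m\<in>multi_indices. \<bar>u m\<bar> * \<rho> ^ mdeg m) \<le> M"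
    "\<forall>x\<in>polydisc \<rho>. ((\<lambda>m. u m * monomial x m) has_sum f x) multi_indices"
    using assms unfolding majorized_def by blast
  show ?thesis
    by (rule that[OF has_sum_infsum[OF u(1)] u(2) u(3)])
qed

text \<open>The l1 norm dominates the sup norm. This keeps the values of an inner function inside a
  disc of convergence; at \<open>x = 0\<close> it also yields that a majorant is
  nonnegative.\<close>

lemma majorized_bound:
  assumes "majorized f \<rho> M" "x \<in> polydisc \<rho>"
  shows "\<bar>f x\<bar> \<le> M"
proof -
  obtain u s where u: "((\<lambda>m. \<bar>u m\<bar> * \<rho> ^ mdeg m) has_sum s) multi_indices" "s \<le> M"
    "\<forall>x\<in>polydisc \<rho>. ((\<lambda>m. u m * monomial x m) has_sum f x) multi_indices"
    by (rule majorizedE[OF assms(1)])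
  have "norm (f x) \<le> s"
    by (rule norm_infsum_le[OF bspec[OF u(3) assms(2)] u(1)]) (auto simp: abs_mult intro!: mult_left_mono abs_monomial_le assms)
  with u(2) show ?thesis by simp
qed

lemma majorized_mono: "majorized f \<rho> M \<Longrightarrow> M \<le> M' \<Longrightarrow> majorized f \<rho> M'"
  unfolding majorized_def by (meson order_trans)

section \<open>Algebraic operations and infinite sums of majorized series\<close>

lemma majorized_const:
  assumes "\<rho> > 0"
  shows "majorized (\<lambda>_. k) \<rho> \<bar>k\<bar>"
\<comment> \<open>A family with one term; the index is a restricted abstraction because
  multi-indices are extensional outside \<open>Basis\<close>.\<close>
proof (rule majorizedI_regroup[where I = "{()}" and d = "\<lambda>_. \<lambda>b\<in>Basis. 0" and c = "\<lambda>_. k"])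
  show "((\<lambda>i. k * monomial x (\<lambda>b\<in>Basis. 0)) has_sum k) {()}" for x :: 'a
    by (rule has_sum_finiteI) (auto simp: monomial_def)
  show "((\<lambda>i. \<bar>k\<bar> * \<rho> ^ mdeg (\<lambda>b::'a\<in>Basis. 0)) has_sum \<bar>k\<bar>) {()}"
    by (rule has_sum_finiteI) (auto simp: mdeg_def)
qed (use assms in auto)

lemma majorized_coordinate:
  assumes "\<rho> > 0" "b \<in> Basis"
  shows "majorized (\<lambda>x. x \<bullet> b) \<rho> \<rho>"
proof (rule majorizedI_regroup[where I = "{()}" and d = "\<lambda>_. \<lambda>b'\<in>Basis. if b' = b then 1 else 0" and c = "\<lambda>_. 1"])
  have "monomial x (\<lambda>b'\<in>Basis. if b' = b then 1 else 0) = x \<bullet> b" for x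
  proof -
    have "monomial x (\<lambda>b'\<in>Basis. if b' = b then 1 else 0) = (\<Prod>b'\<in>Basis. if b' = b then x \<bullet> b else 1)"
      unfolding monomial_def by (rule prod.cong) auto
    then show ?thesis using assms by simp
  qed
  then show "((\<lambda>i. 1 * monomial x (\<lambda>b'\<in>Basis. if b' = b then 1 else 0)) has_sum x \<bullet> b) {()}" for x
    by (intro has_sum_finiteI) auto
  show "((\<lambda>i. \<bar>1\<bar> * \<rho> ^ mdeg (\<lambda>b'\<in>Basis. if b' = b then 1 else 0)) has_sum \<rho>) {()}"
    by (rule has_sum_finiteI) (use assms in \<open>auto simp: mdeg_def\<close>)
qed (use assms in auto)

lemma majorized_add:
  assumes "\<rho> > 0" "majorized f \<rho> M" "majorized g \<rho> M'"
  shows "majorized (\<lambda>x. f x + g x) \<rho> (M + M')"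
proof -
  obtain u s where u: "((\<lambda>m. \<bar>u m\<bar> * \<rho> ^ mdeg m) has_sum s) multi_indices" "s \<le> M"
    "\<forall>x\<in>polydisc \<rho>. ((\<lambda>m. u m * monomial x m) has_sum f x) multi_indices"
    by (rule majorizedE[OF assms(2)])
  obtain v t where v: "((\<lambda>m. \<bar>v m\<bar> * \<rho> ^ mdeg m) has_sum t) multi_indices" "t \<le> M'"
    "\<forall>x\<in>polydisc \<rho>. ((\<lambda>m. v m * monomial x m) has_sum g x) multi_indices"
    by (rule majorizedE[OF assms(3)])
  have st: "((\<lambda>m. \<bar>u m\<bar> * \<rho> ^ mdeg m + \<bar>v m\<bar> * \<rho> ^ mdeg m) has_sum s + t) multi_indices"
    by (rule has_sum_add[OF u(1) v(1)])
  have le: "\<bar>u m + v m\<bar> * \<rho> ^ mdeg m \<le> \<bar>u m\<bar> * \<rho> ^ mdeg m + \<bar>v m\<bar> * \<rho> ^ mdeg m" for m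
    using assms(1) by (simp flip: distrib_right add: mult_right_mono abs_triangle_ineq)
  have sm: "(\<lambda>m. \<bar>u m + v m\<bar> * \<rho> ^ mdeg m) summable_on multi_indices"
    by (rule summable_on_comparison_test[OF has_sum_imp_summable[OF st] le]) (use assms(1) in auto)
  have "(\<Sum>\<^sub>\<infinity>m\<in>multi_indices. \<bar>u m + v m\<bar> * \<rho> ^ mdeg m) \<le> M + M'"
    using infsum_mono[OF sm has_sum_imp_summable[OF st] le] infsumI[OF st] u(2) v(2) by simp
  moreover have "((\<lambda>m. (u m + v m) * monomial x m) has_sum f x + g x) multi_indices"
    if "x \<in> polydisc \<rho>" for x
    using has_sum_add[OF bspec[OF u(3) that] bspec[OF v(3) that]] by (simp add: distrib_right)
  ultimately show ?thesis
    unfolding majorized_def using sm by (intro exI[of _ "\<lambda>m. u m + v m"]) auto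
qed

text \<open>The Cauchy product: pairs of multi-indices \<open>(k, l)\<close> are collected according
  to their sum, on which both the degree weight and the monomial are multiplicative.\<close>

lemma majorized_mult:
  assumes \<rho>: "\<rho> > 0" and "majorized f \<rho> M" "majorized g \<rho> M'"
  shows "majorized (\<lambda>x. f x * g x) \<rho> (M * M')"
proof -
  obtain u s where u: "((\<lambda>m. \<bar>u m\<bar> * \<rho> ^ mdeg m) has_sum s) multi_indices" "s \<le> M"
    "\<forall>x\<in>polydisc \<rho>. ((\<lambda>m. u m * monomial x m) has_sum f x) multi_indices"
    by (rule majorizedE[OF assms(2)])
  obtain v t where v: "((\<lambda>m. \<bar>v m\<bar> * \<rho> ^ mdeg m) has_sum t) multi_indices" "t \<le> M'"
    "\<forall>x\<in>polydisc \<rho>. ((\<lambda>m. v m * monomial x m) has_sum g x) multi_indices"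
    by (rule majorizedE[OF assms(3)])
  define d where "d = (\<lambda>(k, l). \<lambda>b::'a\<in>Basis. k b + l b :: nat)"
  have deg: "mdeg (d (k, l)) = mdeg k + mdeg l" for k l
    by (simp add: mdeg_def d_def sum.distrib)
  have mon: "monomial x (d (k, l)) = monomial x k * monomial x l" for x k l
    by (simp add: monomial_def d_def prod.distrib power_add)
  show ?thesis
  proof (rule majorizedI_regroup[where I = "multi_indices \<times> multi_indices" and d = d
        and c = "\<lambda>(k, l). u k * v l"])
    show "((\<lambda>i. \<bar>case i of (k, l) \<Rightarrow> u k * v l\<bar> * \<rho> ^ mdeg (d i)) has_sum s * t)
            (multi_indices \<times> multi_indices)"
      using has_sum_product_real[OF u(1) v(1)]
      by (rule has_sum_cong[THEN iffD1, rotated]) (auto simp: deg abs_mult power_add)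
    have "0 \<le> s" "0 \<le> t"
      using has_sum_nonneg[OF u(1)] has_sum_nonneg[OF v(1)] \<rho> by auto
    then show "s * t \<le> M * M'"
      using u(2) v(2) by (intro mult_mono) auto
    show "((\<lambda>i. (case i of (k, l) \<Rightarrow> u k * v l) * monomial x (d i)) has_sum f x * g x)
            (multi_indices \<times> multi_indices)" if "x \<in> polydisc \<rho>" for x
      using has_sum_product_real[OF bspec[OF u(3) that] bspec[OF v(3) that]]
      by (rule has_sum_cong[THEN iffD1, rotated]) (auto simp: mon)
  qed (use \<rho> in \<open>auto simp: d_def\<close>)
qed

lemma majorized_power:
  assumes "\<rho> > 0" "majorized f \<rho> M"
  shows "majorized (\<lambda>x. f x ^ k) \<rho> (M ^ k)"
proof (induction k)
  case 0
  show ?case using majorized_const[OF assms(1), of 1] by simp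
next
  case (Suc k)
  show ?case using majorized_mult[OF assms Suc] by simp
qed

text \<open>The Weierstrass M-test for the weighted l1 norm. Summability of the bounds
  \<open>M k\<close> makes the double family over \<open>(k, m)\<close> absolutely summable, so that
  it may be regrouped by \<open>m\<close>.\<close>

lemma majorized_infsum:
  fixes f :: "'i \<Rightarrow> 'a::euclidean_space \<Rightarrow> real"
  assumes \<rho>: "\<rho> > 0" and f: "\<And>k. majorized (f k) \<rho> (M k)" and M: "(M has_sum S) UNIV"
    and F: "\<And>x. x \<in> polydisc \<rho> \<Longrightarrow> ((\<lambda>k. f k x) has_sum F x) UNIV"
  shows "majorized F \<rho> S"
proof -
  have "\<exists>u. \<forall>k. (\<lambda>m. \<bar>u k m\<bar> * \<rho> ^ mdeg m) summable_on multi_indices \<and>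
    (\<Sum>\<^sub>\<infinity>m\<in>multi_indices. \<bar>u k m\<bar> * \<rho> ^ mdeg m) \<le> M k \<and>
    (\<forall>x\<in>polydisc \<rho>. ((\<lambda>m. u k m * monomial x m) has_sum f k x) multi_indices)"
    by (rule choice) (use f in \<open>simp add: majorized_def\<close>)
  then obtain u where u': "\<And>k. (\<lambda>m. \<bar>u k m\<bar> * \<rho> ^ mdeg m) summable_on multi_indices"
    "\<And>k. (\<Sum>\<^sub>\<infinity>m\<in>multi_indices. \<bar>u k m\<bar> * \<rho> ^ mdeg m) \<le> M k"
    "\<And>k x. x \<in> polydisc \<rho> \<Longrightarrow> ((\<lambda>m. u k m * monomial x m) has_sum f k x) multi_indices"
    by blast
  define s where "s k = (\<Sum>\<^sub>\<infinity>m\<in>multi_indices. \<bar>u k m\<bar> * \<rho> ^ mdeg m)" for k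
  have u: "\<And>k. ((\<lambda>m. \<bar>u k m\<bar> * \<rho> ^ mdeg m) has_sum s k) multi_indices" "\<And>k. s k \<le> M k"
    using u'(1,2) by (simp_all add: s_def)
  have s0: "0 \<le> s k" for k
    using has_sum_nonneg[OF u(1)] \<rho> by simp
  have ss: "s summable_on UNIV"
    by (rule summable_on_comparison_test[OF has_sum_imp_summable[OF M] u(2) s0])
  have sum: "(\<lambda>(k, m). \<bar>u k m\<bar> * \<rho> ^ mdeg m) summable_on (UNIV \<times> multi_indices)"
    by (rule summable_on_SigmaI[OF _ ss]) (use u(1) \<rho> in auto)
  show ?thesis
  proof (rule majorizedI_regroup[where I = "UNIV \<times> multi_indices" and d = snd
        and c = "\<lambda>(k, m). u k m"])
    show "((\<lambda>i. \<bar>case i of (k, m) \<Rightarrow> u k m\<bar> * \<rho> ^ mdeg (snd i)) has_sum infsum s UNIV) (UNIV \<times> multi_indices)"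
    proof (rule has_sum_SigmaI)
      show "((\<lambda>y. \<bar>case (k, y) of (k, m) \<Rightarrow> u k m\<bar> * \<rho> ^ mdeg (snd (k, y))) has_sum s k) multi_indices" for k
        using u(1) by simp
      show "(s has_sum infsum s UNIV) UNIV" using ss by simp
      show "(\<lambda>i. \<bar>case i of (k, m) \<Rightarrow> u k m\<bar> * \<rho> ^ mdeg (snd i)) summable_on UNIV \<times> multi_indices"
        using sum by (simp add: case_prod_unfold)
    qed
    show "infsum s UNIV \<le> S"
      using infsum_mono[OF ss has_sum_imp_summable[OF M] u(2)] infsumI[OF M] by simp
    show "((\<lambda>i. (case i of (k, m) \<Rightarrow> u k m) * monomial x (snd i)) has_sum F x) (UNIV \<times> multi_indices)"
      if x: "x \<in> polydisc \<rho>" for x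
    proof (rule has_sum_SigmaI)
      show "((\<lambda>y. (case (k, y) of (k, m) \<Rightarrow> u k m) * monomial x (snd (k, y))) has_sum f k x) multi_indices" for k
        using u'(3)[OF x] by simp
      have "(\<lambda>i. norm ((case i of (k, m) \<Rightarrow> u k m) * monomial x (snd i))) summable_on (UNIV \<times> multi_indices)"
        by (rule Infinite_Sum.abs_summable_on_comparison_test'[OF sum])
           (auto simp: abs_mult intro!: mult_left_mono abs_monomial_le x)
      then show "(\<lambda>i. (case i of (k, m) \<Rightarrow> u k m) * monomial x (snd i)) summable_on (UNIV \<times> multi_indices)"
        by (rule abs_summable_summable)
    qed (rule F[OF x])
  qed (use \<rho> in auto)
qed

section \<open>Smaller polydiscs and composition with a power series\<close>

lemma majorized_shrink:
  fixes f :: "'a::euclidean_space \<Rightarrow> real"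
  assumes f: "majorized f \<rho> M" and \<rho>: "0 < \<rho>'" "\<rho>' \<le> \<rho>"
  shows "majorized f \<rho>' M"
proof -
  obtain u s where u: "((\<lambda>m. \<bar>u m\<bar> * \<rho> ^ mdeg m) has_sum s) multi_indices" "s \<le> M"
    "\<forall>x\<in>polydisc \<rho>. ((\<lambda>m. u m * monomial x m) has_sum f x) multi_indices"
    by (rule majorizedE[OF f])
  have le: "\<bar>u m\<bar> * \<rho>' ^ mdeg m \<le> \<bar>u m\<bar> * \<rho> ^ mdeg m" for m
    using \<rho> by (intro mult_left_mono power_mono) auto
  have sm: "(\<lambda>m. \<bar>u m\<bar> * \<rho>' ^ mdeg m) summable_on multi_indices"
    by (rule summable_on_comparison_test[OF has_sum_imp_summable[OF u(1)] le]) (use \<rho> in auto)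
  moreover have "(\<Sum>\<^sub>\<infinity>m\<in>multi_indices. \<bar>u m\<bar> * \<rho>' ^ mdeg m) \<le> M"
    using infsum_mono[OF sm has_sum_imp_summable[OF u(1)] le] infsumI[OF u(1)] u(2) by simp
  moreover have "polydisc \<rho>' \<subseteq> (polydisc \<rho> :: 'a set)"
    using \<rho> by (auto simp: polydisc_def)
  ultimately show ?thesis
    unfolding majorized_def using u(3) by (intro exI[of _ u]) auto
qed

text \<open>Without a constant term every monomial that occurs has degree at least 1, so each term
  gains at least one factor \<open>\<rho>' / \<rho>\<close>. This is what makes the norm as small as
  composition requires.\<close>

lemma majorized_shrink_zero:
  fixes f :: "'a::euclidean_space \<Rightarrow> real"
  assumes f: "majorized f \<rho> M" and \<rho>: "0 < \<rho>'" "\<rho>' \<le> \<rho>" and f0: "f 0 = 0"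
  shows "majorized f \<rho>' (M * (\<rho>' / \<rho>))"
proof -
  obtain u s where u: "((\<lambda>m. \<bar>u m\<bar> * \<rho> ^ mdeg m) has_sum s) multi_indices" "s \<le> M"
    "\<forall>x\<in>polydisc \<rho>. ((\<lambda>m. u m * monomial x m) has_sum f x) multi_indices"
    by (rule majorizedE[OF f])
  define q where "q = \<rho>' / \<rho>"
  have q: "0 < q" "q \<le> 1" "\<rho>' = q * \<rho>" using \<rho> by (auto simp: q_def)
  define z where "z = (\<lambda>b::'a\<in>Basis. 0::nat)"
  have z: "z \<in> multi_indices" by (auto simp: z_def)
  have nz: "\<exists>b\<in>Basis. m b \<noteq> 0" if "m \<in> multi_indices" "m \<noteq> z" for m :: "'a \<Rightarrow> nat"
    using that(2) PiE_ext[OF that(1) z] by (auto simp: z_def)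
  have mz: "monomial 0 m = (if m = z then 1 else 0)" if "m \<in> multi_indices" for m :: "'a \<Rightarrow> nat"
  proof (cases "m = z")
    case True
    then show ?thesis by (simp add: monomial_def z_def)
  next
    case False
    with nz[OF that] show ?thesis by (auto simp: monomial_def)
  qed
  \<comment> \<open>Evaluation at the origin isolates the coefficient at the zero multi-index
    \<open>z\<close>.\<close>
  have "(0::'a) \<in> polydisc \<rho>" using \<rho> by (simp add: polydisc_def)
  then have "((\<lambda>m. u m * monomial 0 m) has_sum f 0) multi_indices" by (rule bspec[OF u(3)])
  moreover have "((\<lambda>m. u m * monomial 0 m) has_sum u z) multi_indices"
    by (rule has_sum_finite_neutralI[where B = "{z}"]) (use z mz in auto)
  ultimately have uz: "u z = 0" using f0 has_sum_unique by metis
  have le: "\<bar>u m\<bar> * \<rho>' ^ mdeg m \<le> \<bar>u m\<bar> * \<rho> ^ mdeg m * q" if m: "m \<in> multi_indices" for m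
  proof (cases "m = z")
    case True
    then show ?thesis using uz by simp
  next
    case False
    then obtain b where b: "b \<in> Basis" "m b \<noteq> 0" using nz[OF m] by auto
    then have "m b \<le> mdeg m" unfolding mdeg_def by (intro member_le_sum) auto
    with b have "mdeg m \<ge> 1" by linarith
    then have "q ^ mdeg m \<le> q" using power_decreasing[of 1 "mdeg m" q] q by simp
    then have "\<bar>u m\<bar> * \<rho> ^ mdeg m * q ^ mdeg m \<le> \<bar>u m\<bar> * \<rho> ^ mdeg m * q"
      using \<rho> by (intro mult_left_mono) auto
    then show ?thesis by (simp add: q(3) power_mult_distrib mult_ac)
  qed
  have qs: "((\<lambda>m. \<bar>u m\<bar> * \<rho> ^ mdeg m * q) has_sum s * q) multi_indices"
    by (rule has_sum_cmult_left[OF u(1)])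
  have sm: "(\<lambda>m. \<bar>u m\<bar> * \<rho>' ^ mdeg m) summable_on multi_indices"
    by (rule summable_on_comparison_test[OF has_sum_imp_summable[OF qs] le]) (use \<rho> in auto)
  have "(\<Sum>\<^sub>\<infinity>m\<in>multi_indices. \<bar>u m\<bar> * \<rho>' ^ mdeg m) \<le> s * q"
    using infsum_mono[OF sm has_sum_imp_summable[OF qs] le] infsumI[OF qs] by simp
  also have "\<dots> \<le> M * q" using u(2) q by simp
  finally have "(\<Sum>\<^sub>\<infinity>m\<in>multi_indices. \<bar>u m\<bar> * \<rho>' ^ mdeg m) \<le> M * q" .
  moreover have "polydisc \<rho>' \<subseteq> (polydisc \<rho> :: 'a set)"
    using \<rho> by (auto simp: polydisc_def)
  ultimately show ?thesis
    unfolding majorized_def q_def[symmetric] using u(3) sm by (intro exI[of _ u]) auto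
qed

text \<open>The k-th term of the outer series has norm at most
  \<open>\<bar>a k\<bar> * \<sigma> ^ k\<close> by submultiplicativity, so absolute convergence at
  the single radius \<open>\<sigma>\<close> suffices for the M-test.\<close>

lemma majorized_compose:
  fixes f :: "'a::euclidean_space \<Rightarrow> real"
  assumes \<rho>: "\<rho> > 0" and f: "majorized f \<rho> \<sigma>"
    and a: "summable (\<lambda>k. \<bar>a k\<bar> * \<sigma> ^ k)"
    and g: "\<And>s. \<bar>s\<bar> \<le> \<sigma> \<Longrightarrow> (\<lambda>k. a k * s ^ k) sums g s"
  shows "majorized (\<lambda>x. g (f x)) \<rho> (\<Sum>k. \<bar>a k\<bar> * \<sigma> ^ k)"
proof (rule majorized_infsum[where f = "\<lambda>k x. a k * f x ^ k" and M = "\<lambda>k. \<bar>a k\<bar> * \<sigma> ^ k"])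
  have "0 \<le> \<sigma>"
    using majorized_bound[OF f, of 0] \<rho> by (auto simp: polydisc_def)
  show "majorized (\<lambda>x. a k * f x ^ k) \<rho> (\<bar>a k\<bar> * \<sigma> ^ k)" for k
    by (intro majorized_mult majorized_const majorized_power \<rho> f)
  show "((\<lambda>k. \<bar>a k\<bar> * \<sigma> ^ k) has_sum (\<Sum>k. \<bar>a k\<bar> * \<sigma> ^ k)) UNIV"
    by (rule norm_summable_imp_has_sum) (use a \<open>0 \<le> \<sigma>\<close> in \<open>auto simp: summable_sums\<close>)
  show "((\<lambda>k. a k * f x ^ k) has_sum g (f x)) UNIV" if x: "x \<in> polydisc \<rho>" for x
  proof (rule norm_summable_imp_has_sum)
    have fx: "\<bar>f x\<bar> \<le> \<sigma>" by (rule majorized_bound[OF f x])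
    show "(\<lambda>k. a k * f x ^ k) sums g (f x)" by (rule g[OF fx])
    show "summable (\<lambda>k. norm (a k * f x ^ k))"
      by (rule summable_comparison_test[OF _ a])
         (use fx in \<open>auto simp: abs_mult power_abs intro!: mult_left_mono power_mono\<close>)
  qed
qed (rule \<rho>)

section \<open>Analytic germs\<close>

definition analytic_germ :: "('a::euclidean_space \<Rightarrow> real) \<Rightarrow> 'a \<Rightarrow> bool"
  where "analytic_germ f a \<longleftrightarrow> (\<exists>\<rho>>0. \<exists>M. majorized (\<lambda>h. f (a + h)) \<rho> M)"

lemma ball_subset_polydisc: "x \<in> ball a \<rho> \<Longrightarrow> x - a \<in> polydisc \<rho>"
  unfolding polydisc_def
  by (auto simp: dist_norm norm_minus_commute intro: order_trans[OF Basis_le_norm])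

lemma analytic_germ_const: "analytic_germ (\<lambda>_. k) a"
  unfolding analytic_germ_def using majorized_const[of 1 k] zero_less_one by blast

lemma analytic_germ_add:
  assumes "analytic_germ f a" "analytic_germ g a"
  shows "analytic_germ (\<lambda>x. f x + g x) a"
proof -
  obtain \<rho> M \<rho>' M' where *: "\<rho> > 0" "\<rho>' > 0" "majorized (\<lambda>h. f (a + h)) \<rho> M"
    "majorized (\<lambda>h. g (a + h)) \<rho>' M'"
    using assms unfolding analytic_germ_def by blast
  have "majorized (\<lambda>h. f (a + h)) (min \<rho> \<rho>') M" "majorized (\<lambda>h. g (a + h)) (min \<rho> \<rho>') M'"
    using majorized_shrink[OF *(3), of "min \<rho> \<rho>'"] majorized_shrink[OF *(4), of "min \<rho> \<rho>'"] *(1,2)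
    by simp_all
  then have "majorized (\<lambda>h. f (a + h) + g (a + h)) (min \<rho> \<rho>') (M + M')"
    using *(1,2) by (intro majorized_add) auto
  moreover have "min \<rho> \<rho>' > 0" using *(1,2) by simp
  ultimately show ?thesis
    unfolding analytic_germ_def by blast
qed

lemma analytic_germ_mult:
  assumes "analytic_germ f a" "analytic_germ g a"
  shows "analytic_germ (\<lambda>x. f x * g x) a"
proof -
  obtain \<rho> M \<rho>' M' where *: "\<rho> > 0" "\<rho>' > 0" "majorized (\<lambda>h. f (a + h)) \<rho> M"
    "majorized (\<lambda>h. g (a + h)) \<rho>' M'"
    using assms unfolding analytic_germ_def by blast
  have "majorized (\<lambda>h. f (a + h)) (min \<rho> \<rho>') M" "majorized (\<lambda>h. g (a + h)) (min \<rho> \<rho>') M'"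
    using majorized_shrink[OF *(3), of "min \<rho> \<rho>'"] majorized_shrink[OF *(4), of "min \<rho> \<rho>'"] *(1,2)
    by simp_all
  then have "majorized (\<lambda>h. f (a + h) * g (a + h)) (min \<rho> \<rho>') (M * M')"
    using *(1,2) by (intro majorized_mult) auto
  moreover have "min \<rho> \<rho>' > 0" using *(1,2) by simp
  ultimately show ?thesis
    unfolding analytic_germ_def by blast
qed

lemma analytic_germ_power: "analytic_germ f a \<Longrightarrow> analytic_germ (\<lambda>x. f x ^ n) a"
  by (induction n) (simp_all add: analytic_germ_const analytic_germ_mult)

lemma analytic_germ_diff:
  assumes "analytic_germ f a" "analytic_germ g a"
  shows "analytic_germ (\<lambda>x. f x - g x) a"
  using analytic_germ_add[OF assms(1) analytic_germ_mult[OF analytic_germ_const[of "-1"] assms(2)]] by simp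

lemma analytic_germ_sum:
  assumes "\<And>i. i \<in> I \<Longrightarrow> analytic_germ (f i) a"
  shows "analytic_germ (\<lambda>x. \<Sum>i\<in>I. f i x) a"
  using assms
  by (induction I rule: infinite_finite_induct) (simp_all add: analytic_germ_const analytic_germ_add)

text \<open>An arbitrary vector \<open>v\<close> is allowed so that coordinates of a product space
  are obtained as inner products with explicit triples.\<close>

lemma analytic_germ_inner: "analytic_germ (\<lambda>x. x \<bullet> v) a"
proof -
  have "analytic_germ (\<lambda>x. x \<bullet> b) a" if "b \<in> Basis" for b
  proof -
    have "majorized (\<lambda>h. a \<bullet> b + h \<bullet> b) 1 (\<bar>a \<bullet> b\<bar> + 1)"
      using that by (intro majorized_add majorized_const majorized_coordinate) auto
    then show ?thesis
      unfolding analytic_germ_def by (intro exI[of _ 1]) (auto simp: inner_add_left)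
  qed
  then have "analytic_germ (\<lambda>x. \<Sum>b\<in>Basis. (x \<bullet> b) * (v \<bullet> b)) a"
    by (intro analytic_germ_sum analytic_germ_mult analytic_germ_const)
  then show ?thesis
    by (simp flip: euclidean_inner)
qed

lemma analytic_germ_cong:
  assumes g: "analytic_germ g a" and eq: "\<forall>\<^sub>F x in nhds a. f x = g x"
  shows "analytic_germ f a"
proof -
  obtain \<rho> M where \<rho>: "\<rho> > 0" "majorized (\<lambda>h. g (a + h)) \<rho> M"
    using g unfolding analytic_germ_def by blast
  obtain e where e: "e > 0" "\<And>x. dist x a < e \<Longrightarrow> f x = g x"
    using eq unfolding eventually_nhds_metric by blast
  \<comment> \<open>The l1 norm on this polydisc is at most \<open>DIM('a) * \<rho>'\<close>, hence
    at most e/2, which places the polydisc strictly inside the ball of radius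
    \<open>e\<close>.\<close>
  define \<rho>' where "\<rho>' = min \<rho> (e / (2 * DIM('a)))"
  have \<rho>': "\<rho>' > 0" "\<rho>' \<le> \<rho>"
    using \<rho> e by (auto simp: \<rho>'_def)
  have fg: "f (a + h) = g (a + h)" if "h \<in> polydisc \<rho>'" for h
  proof -
    have "norm h \<le> (\<Sum>b\<in>Basis. \<bar>h \<bullet> b\<bar>)" by (rule norm_le_l1)
    also have "\<dots> \<le> (\<Sum>b\<in>(Basis::'a set). \<rho>')"
      using that by (intro sum_mono) (auto simp: polydisc_def)
    also have "\<dots> = DIM('a) * \<rho>'" by simp
    also have "\<dots> \<le> DIM('a) * (e / (2 * DIM('a)))"
      by (intro mult_left_mono) (auto simp: \<rho>'_def)
    also have "\<dots> < e" using e by simp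
    finally show ?thesis by (intro e) (simp add: dist_norm)
  qed
  have "majorized (\<lambda>h. g (a + h)) \<rho>' M"
    using majorized_shrink[OF \<rho>(2) \<rho>'] .
  then have "majorized (\<lambda>h. f (a + h)) \<rho>' M"
    unfolding majorized_def using fg by simp
  then show ?thesis
    unfolding analytic_germ_def using \<rho>' by blast
qed

lemma has_sum_finite_sum:
  fixes f :: "'i \<Rightarrow> 'm \<Rightarrow> 'b::real_normed_vector"
  assumes "\<And>i. i \<in> I \<Longrightarrow> (f i has_sum s i) A"
  shows "((\<lambda>m. \<Sum>i\<in>I. f i m) has_sum (\<Sum>i\<in>I. s i)) A"
  using assms by (induction I rule: infinite_finite_induct) (simp_all add: has_sum_add)

text \<open>The scalar series of the finitely many components converge on a common ball and are
  assembled into one series with vector coefficients.\<close>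

lemma real_analytic_onI:
  fixes f :: "'a::euclidean_space \<Rightarrow> 'b::euclidean_space"
  assumes "\<And>a b. a \<in> S \<Longrightarrow> b \<in> Basis \<Longrightarrow> analytic_germ (\<lambda>x. f x \<bullet> b) a"
  shows "f real_analytic_on S"
  unfolding real_analytic_on_def
proof
  fix a assume a: "a \<in> S"
  have "\<exists>r>0. \<exists>u. \<forall>x\<in>ball a r. ((\<lambda>m. u m * monomial (x - a) m) has_sum f x \<bullet> b) multi_indices"
    if b: "b \<in> Basis" for b
  proof -
    obtain \<rho> M where "\<rho> > 0" "majorized (\<lambda>h. f (a + h) \<bullet> b) \<rho> M"
      using assms[OF a b] unfolding analytic_germ_def by blast
    moreover from this obtain u where
      u: "\<forall>h\<in>polydisc \<rho>. ((\<lambda>m. u m * monomial h m) has_sum f (a + h) \<bullet> b) multi_indices"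
      unfolding majorized_def by blast
    ultimately show ?thesis
      using bspec[OF u ball_subset_polydisc[of _ a]] by (intro exI[of _ \<rho>] conjI exI[of _ u]) auto
  qed
  then have "\<forall>b. \<exists>r. b \<in> Basis \<longrightarrow> r > 0 \<and>
      (\<exists>u. \<forall>x\<in>ball a r. ((\<lambda>m. u m * monomial (x - a) m) has_sum f x \<bullet> b) multi_indices)"
    by blast
  from choice[OF this] obtain r where r: "\<And>b. b \<in> Basis \<Longrightarrow> r b > 0"
    and "\<forall>b\<in>Basis. \<exists>u. \<forall>x\<in>ball a (r b). ((\<lambda>m. u m * monomial (x - a) m) has_sum f x \<bullet> b) multi_indices"
    by blast
  from bchoice[OF this(2)] obtain u where
    u: "\<And>b x. b \<in> Basis \<Longrightarrow> x \<in> ball a (r b) \<Longrightarrow>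
      ((\<lambda>m. u b m * monomial (x - a) m) has_sum f x \<bullet> b) multi_indices"
    by blast
  define R where "R = Min (r ` Basis)"
  have R: "R > 0" "\<And>b. b \<in> Basis \<Longrightarrow> R \<le> r b"
    using r by (auto simp: R_def)
  have "((\<lambda>m. (\<Prod>b\<in>Basis. ((x - a) \<bullet> b) ^ m b) *\<^sub>R (\<Sum>b\<in>Basis. u b m *\<^sub>R b)) has_sum f x) multi_indices"
    if x: "x \<in> ball a R" for x
  proof -
    have "((\<lambda>m. \<Sum>b\<in>Basis. (u b m * monomial (x - a) m) *\<^sub>R b) has_sum (\<Sum>b\<in>Basis. (f x \<bullet> b) *\<^sub>R b)) multi_indices"
    proof (rule has_sum_finite_sum)
      fix b :: 'b assume b: "b \<in> Basis"
      with x R(2)[OF b] have "x \<in> ball a (r b)" by simp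
      from has_sum_bounded_linear[OF bounded_linear_scaleR_left u[OF b this]]
      show "((\<lambda>m. (u b m * monomial (x - a) m) *\<^sub>R b) has_sum (f x \<bullet> b) *\<^sub>R b) multi_indices" .
    qed
    then show ?thesis
      by (simp add: euclidean_representation scaleR_sum_right monomial_def mult.commute)
  qed
  then show "\<exists>u r. r > 0 \<and> (\<forall>x\<in>ball a r. ((\<lambda>m. (\<Prod>b\<in>Basis. ((x - a) \<bullet> b) ^ m b) *\<^sub>R u m) has_sum f x) multi_indices)"
    using R(1) by (intro exI[of _ "\<lambda>m. \<Sum>b\<in>Basis. u b m *\<^sub>R b"] exI[of _ R]) auto
qed

section \<open>Functions of one real variable with a holomorphic extension\<close>

text \<open>A holomorphic extension fixes the disc on which the Taylor series converges to the
  function, and it lets removable singularities and local inverses be treated by complex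
  analysis.\<close>

definition complexifiable :: "(real \<Rightarrow> real) \<Rightarrow> real \<Rightarrow> bool"
  where "complexifiable g s \<longleftrightarrow> (\<exists>r>0. \<exists>F. F holomorphic_on ball (of_real s) r \<and>
    (\<forall>t. \<bar>t - s\<bar> < r \<longrightarrow> F (complex_of_real t) = of_real (g t)))"

lemma complexifiableI:
  assumes "F holomorphic_on S" "open S" "complex_of_real s \<in> S"
    and "\<And>t. complex_of_real t \<in> S \<Longrightarrow> F (of_real t) = of_real (g t)"
  shows "complexifiable g s"
proof -
  obtain r where r: "r > 0" "ball (complex_of_real s) r \<subseteq> S"
    using assms(2,3) unfolding open_contains_ball by blast
  show ?thesis
    unfolding complexifiable_def
  proof (intro exI[of _ r] exI[of _ F] conjI allI impI)
    show "F holomorphic_on ball (of_real s) r"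
      using assms(1) r(2) holomorphic_on_subset by blast
    fix t assume "\<bar>t - s\<bar> < r"
    then have "complex_of_real t \<in> ball (of_real s) r"
      by (simp add: dist_norm norm_of_real abs_minus_commute flip: of_real_diff)
    then show "F (of_real t) = of_real (g t)"
      using assms(4) r(2) by blast
  qed (rule r)
qed

lemma analytic_germ_compose:
  assumes f: "analytic_germ f a" and g: "complexifiable g (f a)"
  shows "analytic_germ (\<lambda>x. g (f x)) a"
proof -
  obtain r F where r: "r > 0" and F: "F holomorphic_on ball (of_real (f a)) r"
    "\<And>t. \<bar>t - f a\<bar> < r \<Longrightarrow> F (complex_of_real t) = of_real (g t)"
    using g unfolding complexifiable_def by blast
  \<comment> \<open>Values of \<open>F\<close> and powers of the increment are real on the real
    axis, so the real parts of the Taylor coefficients already give a series for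
    \<open>g\<close>.\<close>
  define c where "c k = Re ((deriv ^^ k) F (of_real (f a)) / fact k)" for k
  have sums: "(\<lambda>k. c k * t ^ k) sums g (f a + t)" if t: "\<bar>t\<bar> < r" for t
  proof -
    have "complex_of_real (f a + t) \<in> ball (of_real (f a)) r"
      using t by (simp add: dist_norm norm_of_real)
    from holomorphic_power_series[OF F(1) this]
    have "(\<lambda>k. (deriv ^^ k) F (of_real (f a)) / fact k * of_real (t ^ k)) sums of_real (g (f a + t))"
      using F(2)[of "f a + t"] t by simp
    from sums_Re[OF this] show ?thesis
      unfolding c_def by (simp only: times_complex.sel Re_complex_of_real Im_complex_of_real
          mult_zero_right diff_zero)
  qed
  define \<sigma> where "\<sigma> = r / 2"
  have \<sigma>: "\<sigma> > 0" "\<sigma> < r" using r by (auto simp: \<sigma>_def)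
  \<comment> \<open>Convergence at 3r/4, strictly between \<open>\<sigma>\<close> = r/2 and
    \<open>r\<close>, gives absolute convergence at \<open>\<sigma>\<close>.\<close>
  have "summable (\<lambda>k. c k * (3 * r / 4) ^ k)"
    using sums[of "3 * r / 4"] r by (auto simp: sums_iff)
  then have "summable (\<lambda>k. norm (c k * \<sigma> ^ k))"
    by (rule powser_insidea) (use r in \<open>auto simp: \<sigma>_def\<close>)
  then have summ: "summable (\<lambda>k. \<bar>c k\<bar> * \<sigma> ^ k)"
    using \<sigma> by (simp add: abs_mult)
  obtain \<rho> M where \<rho>: "\<rho> > 0" "majorized (\<lambda>h. f (a + h)) \<rho> M"
    using f unfolding analytic_germ_def by blast
  define M' where "M' = M + \<bar>- f a\<bar>"
  have M': "majorized (\<lambda>h. f (a + h) + - f a) \<rho> M'"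
    unfolding M'_def using \<rho> by (intro majorized_add majorized_const) auto
  have "0 \<le> M'"
    using majorized_bound[OF M', of 0] \<rho> by (auto simp: polydisc_def)
  \<comment> \<open>Chosen so that the linear gain brings the norm of f(a + h) - f(a) from
    \<open>M'\<close> down to \<open>\<sigma>\<close>; the summand 1 keeps the denominator
    positive.\<close>
  define \<rho>' where "\<rho>' = min \<rho> (\<rho> * \<sigma> / (M' + 1))"
  have \<rho>': "0 < \<rho>'" "\<rho>' \<le> \<rho>"
    using \<rho> \<sigma> \<open>0 \<le> M'\<close> by (auto simp: \<rho>'_def)
  have "M' * (\<rho>' / \<rho>) \<le> M' * ((\<rho> * \<sigma> / (M' + 1)) / \<rho>)"
    using \<rho> \<open>0 \<le> M'\<close> by (intro mult_left_mono divide_right_mono) (auto simp: \<rho>'_def)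
  also have "\<dots> = M' / (M' + 1) * \<sigma>"
    using \<rho> by simp
  also have "\<dots> \<le> 1 * \<sigma>"
    using \<open>0 \<le> M'\<close> \<sigma> by (intro mult_right_mono) auto
  finally have "M' * (\<rho>' / \<rho>) \<le> \<sigma>" by simp
  then have "majorized (\<lambda>h. f (a + h) + - f a) \<rho>' \<sigma>"
    using majorized_shrink_zero[OF M' \<rho>'] majorized_mono by auto
  then have "majorized (\<lambda>h. g (f a + (f (a + h) + - f a))) \<rho>' (\<Sum>k. \<bar>c k\<bar> * \<sigma> ^ k)"
    by (rule majorized_compose[OF \<rho>'(1) _ summ, where g = "\<lambda>t. g (f a + t)"])
       (use sums \<sigma> in auto)
  then show ?thesis
    unfolding analytic_germ_def using \<rho>' by auto
qed

text \<open>The holomorphic extension of \<open>f\<close> is locally invertible because its complex derivative at a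
  real point is the real derivative of \<open>f\<close>.\<close>

lemma complexifiable_inverse:
  assumes f: "complexifiable f s" and D: "(f has_real_derivative D) (at s)" "D \<noteq> 0"
    and mono: "strict_mono f" and cont: "continuous_on UNIV f" and g: "\<And>x. g (f x) = x"
  shows "complexifiable g (f s)"
proof -
  obtain r F where r: "r > 0" and F: "F holomorphic_on ball (of_real s) r"
    "\<And>t. \<bar>t - s\<bar> < r \<Longrightarrow> F (complex_of_real t) = of_real (f t)"
    using f unfolding complexifiable_def by blast
  have "(F has_field_derivative deriv F (of_real s)) (at (of_real s))"
    using F(1) r by (simp add: holomorphic_derivI)
  then have "((\<lambda>t. F (of_real t)) has_vector_derivative deriv F (of_real s)) (at s)"
    by (rule has_vector_derivative_real_field)
  moreover have "((\<lambda>t. F (of_real t)) has_vector_derivative of_real D) (at s)"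
  proof (rule has_vector_derivative_transform_within_open[where S = "ball s r"])
    show "((\<lambda>t. complex_of_real (f t)) has_vector_derivative of_real D) (at s)"
      by (rule has_vector_derivative_of_real[OF D(1)])
  qed (use F(2) r in \<open>auto simp: dist_norm abs_minus_commute\<close>)
  ultimately have "deriv F (of_real s) = of_real D"
    by (rule vector_derivative_unique_at)
  then have dnz: "deriv F (of_real s) \<noteq> 0" using D(2) by simp
  have "complex_of_real s \<in> ball (of_real s) r" using r by simp
  from has_complex_derivative_locally_injective[OF F(1) this open_ball dnz]
  obtain r' where r': "r' > 0" "ball (of_real s) r' \<subseteq> ball (complex_of_real s) r"
      "inj_on F (ball (of_real s) r')"
    by blast
  define B where "B = ball (complex_of_real s) r'"
  have holB: "F holomorphic_on B" "open B" "inj_on F B"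
    using holomorphic_on_subset[OF F(1) r'(2)] r'(3) unfolding B_def by auto
  have "\<exists>G. G holomorphic_on F ` B \<and> (\<forall>z\<in>B. G (F z) = z)"
    by (rule holomorphic_has_inverse[OF holB]) blast
  then obtain G where G: "G holomorphic_on F ` B" "\<And>z. z \<in> B \<Longrightarrow> G (F z) = z"
    by blast
  have ofs: "open (F ` B)" by (rule open_mapping_thm3[OF holB])
  have sB: "complex_of_real s \<in> B" using r' by (simp add: B_def)
  have "complex_of_real (f s) \<in> F ` B"
    using F(2)[of s] r sB by force
  then obtain e where e: "e > 0" "ball (complex_of_real (f s)) e \<subseteq> F ` B"
    using ofs unfolding open_contains_ball by blast
  define \<epsilon> where "\<epsilon> = r' / 2"
  have \<epsilon>: "\<epsilon> > 0" "\<epsilon> < r'" using r' by (auto simp: \<epsilon>_def)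
  \<comment> \<open>\<open>e\<close> keeps the disc inside the image of \<open>B\<close>. The other
    two terms let the intermediate value theorem place a real preimage within
    \<open>\<epsilon>\<close> of \<open>s\<close>, hence in \<open>B\<close>, where injectivity
    identifies it with the value of \<open>G\<close>.\<close>
  define \<delta> where "\<delta> = min e (min (f (s + \<epsilon>) - f s) (f s - f (s - \<epsilon>)))"
  have "\<delta> > 0"
    using e \<epsilon> strict_monoD[OF mono, of s "s + \<epsilon>"] strict_monoD[OF mono, of "s - \<epsilon>" s]
    by (auto simp: \<delta>_def)
  moreover have "G holomorphic_on ball (of_real (f s)) \<delta>"
    by (rule holomorphic_on_subset[OF G(1)]) (use e in \<open>auto simp: \<delta>_def\<close>)
  moreover have "G (of_real t) = of_real (g t)" if t: "\<bar>t - f s\<bar> < \<delta>" for t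
  proof -
    have "\<exists>x\<ge>s - \<epsilon>. x \<le> s + \<epsilon> \<and> f x = t"
      using t \<epsilon> by (intro IVT' continuous_on_subset[OF cont]) (auto simp: \<delta>_def)
    then obtain x where "x \<ge> s - \<epsilon>" "x \<le> s + \<epsilon>" and fx: "f x = t" by blast
    then have x: "\<bar>x - s\<bar> \<le> \<epsilon>" by (simp add: abs_le_iff)
    have xB: "complex_of_real x \<in> B"
      using x \<epsilon> by (simp add: B_def dist_norm norm_of_real abs_minus_commute flip: of_real_diff)
    then have "complex_of_real x \<in> ball (of_real s) r" using r' B_def by blast
    then have "\<bar>x - s\<bar> < r"
      by (simp add: dist_norm norm_of_real abs_minus_commute flip: of_real_diff)
    then show ?thesis
      using G(2)[OF xB] F(2)[of x] fx g[of x] by auto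
  qed
  ultimately show ?thesis
    unfolding complexifiable_def by blast
qed

section \<open>The functions involved in the exponential mapping\<close>

definition sinhc :: "real \<Rightarrow> real"
  where "sinhc x = (if x = 0 then 1 else sinh x / x)"

text \<open>Chosen because the vertical coordinate of \<open>Exp\<close> is
  \<open>t\<^sup>2 * sinhc2 (c * t) / 2\<close>. The value 0 is the limit, as sinh x - x is of order
  x^3.\<close>

definition sinhc2 :: "real \<Rightarrow> real"
  where "sinhc2 x = (if x = 0 then 0 else (sinh x - x) / x\<^sup>2)"

definition csinhc :: "complex \<Rightarrow> complex"
  where "csinhc z = (if z = 0 then 1 else sinh z / z)"

definition csinhc2 :: "complex \<Rightarrow> complex"
  where "csinhc2 z = (if z = 0 then 0 else (sinh z - z) / z\<^sup>2)"

lemma sinh_complex_of_real: "sinh (complex_of_real x) = of_real (sinh x)"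
  by (simp add: sinh_field_def exp_of_real[symmetric])

lemma cosh_complex_of_real: "cosh (complex_of_real x) = of_real (cosh x)"
  by (simp add: cosh_field_def exp_of_real[symmetric])

lemma csinhc_of_real: "csinhc (of_real x) = of_real (sinhc x)"
  by (simp add: csinhc_def sinhc_def sinh_complex_of_real)

lemma csinhc2_of_real: "csinhc2 (of_real x) = of_real (sinhc2 x)"
  by (simp add: csinhc2_def sinhc2_def sinh_complex_of_real)

lemma sinh_holomorphic: "(sinh :: complex \<Rightarrow> complex) holomorphic_on A"
  unfolding sinh_field_def[abs_def] by (intro holomorphic_intros) auto

lemma cosh_holomorphic: "(cosh :: complex \<Rightarrow> complex) holomorphic_on A"
  unfolding cosh_field_def[abs_def] by (intro holomorphic_intros) auto

text \<open>This is the difference quotient of sinh at 0, completed by the derivative there, so the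
  singularity is removable.\<close>

lemma csinhc_holomorphic: "csinhc holomorphic_on A"
proof -
  have "(sinh has_field_derivative cosh 0) (at (0::complex))"
    by (auto intro!: derivative_eq_intros)
  then have "deriv sinh (0::complex) = 1"
    by (simp add: DERIV_imp_deriv)
  then have "csinhc = (\<lambda>z. if z = 0 then deriv sinh 0 else (sinh z - sinh 0) / (z - 0))"
    by (auto simp: csinhc_def)
  then have "csinhc holomorphic_on UNIV"
    using pole_lemma[OF sinh_holomorphic[of UNIV], of 0] by simp
  then show ?thesis
    by (rule holomorphic_on_subset) simp
qed

text \<open>The same argument once more, now for the difference quotient of \<open>csinhc\<close> at
  0. The value 0 is the correct one because \<open>csinhc\<close> is even and so has vanishing
  derivative at 0.\<close>

lemma csinhc2_holomorphic: "csinhc2 holomorphic_on A"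
proof -
  have D: "(csinhc has_field_derivative deriv csinhc 0) (at 0)"
    using csinhc_holomorphic[of UNIV] by (simp add: holomorphic_derivI)
  have even: "(\<lambda>z. csinhc (- z)) = csinhc"
    by (rule ext) (simp add: csinhc_def)
  have "((\<lambda>z. csinhc (- z)) has_field_derivative deriv csinhc 0 * (- 1)) (at 0)"
    using D by (intro DERIV_chain2[where f = csinhc]) (auto intro!: derivative_eq_intros)
  then have "(csinhc has_field_derivative deriv csinhc 0 * (- 1)) (at 0)"
    unfolding even .
  from DERIV_unique[OF D this] have "deriv csinhc 0 + deriv csinhc 0 = 0"
    by (simp only: mult_minus1_right eq_neg_iff_add_eq_0)
  then have "2 * deriv csinhc 0 = 0"
    by (simp only: mult_2)
  then have "deriv csinhc 0 = 0"
    by simp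
  then have "csinhc2 = (\<lambda>z. if z = 0 then deriv csinhc 0 else (csinhc z - csinhc 0) / (z - 0))"
    by (auto simp: csinhc2_def csinhc_def field_simps power2_eq_square)
  then have "csinhc2 holomorphic_on UNIV"
    using pole_lemma[OF csinhc_holomorphic[of UNIV], of 0] by simp
  then show ?thesis
    by (rule holomorphic_on_subset) simp
qed

lemma sinhc_pos: "sinhc x > 0"
  by (auto simp: sinhc_def zero_less_divide_iff not_less)

lemma times_sinhc: "x * sinhc x = sinh x"
  by (simp add: sinhc_def)

text \<open>Dividing numerator and denominator by 4p^2 removes the case distinction at 0.\<close>

lemma alpha_eq_sinhc: "alpha p = sinhc2 (2 * p) / (2 * (sinhc p)\<^sup>2)"
  by (simp add: alpha_def sinhc2_def sinhc_def field_simps)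

lemma complexifiable_sinh: "complexifiable sinh s"
  by (rule complexifiableI[OF sinh_holomorphic[of UNIV]]) (auto simp: sinh_complex_of_real)

lemma complexifiable_cosh: "complexifiable cosh s"
  by (rule complexifiableI[OF cosh_holomorphic[of UNIV]]) (auto simp: cosh_complex_of_real)

lemma complexifiable_sinhc: "complexifiable sinhc s"
  by (rule complexifiableI[OF csinhc_holomorphic[of UNIV]]) (auto simp: csinhc_of_real)

lemma complexifiable_sinhc2: "complexifiable sinhc2 s"
  by (rule complexifiableI[OF csinhc2_holomorphic[of UNIV]]) (auto simp: csinhc2_of_real)

lemma complexifiable_inverse_fun: "s \<noteq> 0 \<Longrightarrow> complexifiable inverse s"
  by (rule complexifiableI[of inverse "- {0}"]) (auto intro!: holomorphic_intros)

lemma complexifiable_sqrt: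
  assumes "s > 0"
  shows "complexifiable sqrt s"
proof (rule complexifiableI[of csqrt "{z. Re z > 0}"])
  show "csqrt holomorphic_on {z. Re z > 0}"
    by (intro holomorphic_intros) (auto simp: complex_nonpos_Reals_iff)
qed (use assms in \<open>auto simp: open_halfspace_Re_gt csqrt_of_real\<close>)

text \<open>On the strip where the real part lies between -1 and 1, both 1 + z and 1 - z have
  positive real part and avoid the branch cut of \<open>Ln\<close>.\<close>

lemma complexifiable_artanh:
  assumes "\<bar>s\<bar> < 1"
  shows "complexifiable artanh s"
proof (rule complexifiableI[of "\<lambda>z. (Ln (1 + z) - Ln (1 - z)) / 2" "{z. Re z > -1} \<inter> {z. Re z < 1}"])
  show "(\<lambda>z. (Ln (1 + z) - Ln (1 - z)) / 2) holomorphic_on {z. Re z > -1} \<inter> {z. Re z < 1}"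
    by (intro holomorphic_intros) (auto simp: complex_nonpos_Reals_iff)
  fix t assume "complex_of_real t \<in> {z. Re z > -1} \<inter> {z. Re z < 1}"
  then have t: "1 + t > 0" "1 - t > 0" by auto
  have "Ln (complex_of_real (1 + t)) = of_real (ln (1 + t))"
       "Ln (complex_of_real (1 - t)) = of_real (ln (1 - t))"
    using t by (simp_all only: Ln_of_real)
  then show "(Ln (1 + complex_of_real t) - Ln (1 - complex_of_real t)) / 2 = of_real (artanh t)"
    using t by (simp add: artanh_def ln_div)
qed (use assms in \<open>auto simp: open_halfspace_Re_gt open_halfspace_Re_lt open_Int\<close>)

text \<open>The only poles of the extension are zeros of \<open>csinhc\<close>; these form a closed
  set that misses the real axis.\<close>

lemma complexifiable_alpha: "complexifiable alpha s"
proof (rule complexifiableI[of "\<lambda>z. csinhc2 (2 * z) / (2 * (csinhc z)\<^sup>2)" "{z. csinhc z \<noteq> 0}"])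
  have "(csinhc2 \<circ> (\<lambda>z. 2 * z)) holomorphic_on {z. csinhc z \<noteq> 0}"
    by (intro holomorphic_on_compose holomorphic_intros csinhc2_holomorphic)
  then show "(\<lambda>z. csinhc2 (2 * z) / (2 * (csinhc z)\<^sup>2)) holomorphic_on {z. csinhc z \<noteq> 0}"
    by (intro holomorphic_on_divide holomorphic_on_mult holomorphic_on_power holomorphic_on_const
        csinhc_holomorphic) (auto simp: o_def)
  have "continuous_on UNIV csinhc"
    using csinhc_holomorphic holomorphic_on_imp_continuous_on by blast
  then show "open {z. csinhc z \<noteq> 0}"
    by (intro open_Collect_neq continuous_on_const)
  show "complex_of_real s \<in> {z. csinhc z \<noteq> 0}"
    using sinhc_pos[of s] by (simp add: csinhc_of_real)
  show "csinhc2 (2 * complex_of_real t) / (2 * (csinhc (complex_of_real t))\<^sup>2) = of_real (alpha t)" for t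
    using csinhc2_of_real[of "2 * t"] by (simp add: alpha_eq_sinhc csinhc_of_real)
qed

section \<open>Monotonicity, limit and range of \<open>alpha\<close>, and its inverse
  \<open>beta\<close>\<close>

lemma cosh_minus_sinh_pos:
  assumes "(p::real) > 0"
  shows "p * cosh p - sinh p > 0"
proof -
  have "(\<lambda>p. p * cosh p - sinh p) 0 < p * cosh p - sinh p"
  proof (rule DERIV_pos_imp_increasing_open[OF assms])
    fix x :: real assume "0 < x" "x < p"
    then show "\<exists>y. ((\<lambda>p. p * cosh p - sinh p) has_real_derivative y) (at x) \<and> y > 0"
      \<comment> \<open>The terms \<open>cosh x\<close> cancel in the derivative, leaving
        \<open>x * sinh x\<close>, while the function itself vanishes at 0.\<close>
      by (intro exI[of _ "x * sinh x"]) (auto intro!: derivative_eq_intros)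
  qed (auto intro!: continuous_intros)
  then show ?thesis by simp
qed

lemma alpha_has_derivative:
  "\<exists>D>0. (alpha has_real_derivative D) (at p)"
proof (cases "p = 0")
  case True
  \<comment> \<open>To leading order the numerator is 8p^3/6 and the denominator 8p^2, whence the
    slope 1/6.\<close>
  have "((\<lambda>p::real. ((sinh (2 * p) - 2 * p) / (8 * (sinh p)\<^sup>2)) / p) \<longlongrightarrow> 1 / 6) (at 0)"
    by real_asymp
  then have "((\<lambda>p. (alpha p - alpha 0) / (p - 0)) \<longlongrightarrow> 1 / 6) (at 0)"
    by (rule Lim_transform_eventually) (auto simp: alpha_def eventually_at intro!: exI[of _ 1])
  then have "(alpha has_real_derivative 1 / 6) (at 0)"
    by (simp add: has_field_derivative_iff)
  then show ?thesis using True by (intro exI[of _ "1 / 6"]) auto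
next
  case False
  define D where "D = (p * cosh p - sinh p) / (2 * sinh p ^ 3)"
  have "((\<lambda>p. (sinh (2 * p) - 2 * p) / (8 * (sinh p)\<^sup>2)) has_real_derivative
      ((2 * cosh (2 * p) - 2) * (8 * (sinh p)\<^sup>2) - (sinh (2 * p) - 2 * p) * (16 * sinh p * cosh p))
      / (8 * (sinh p)\<^sup>2)\<^sup>2) (at p)"
    using False by (auto intro!: derivative_eq_intros simp: power2_eq_square)
  also have "((2 * cosh (2 * p) - 2) * (8 * (sinh p)\<^sup>2) - (sinh (2 * p) - 2 * p) * (16 * sinh p * cosh p))
      = 32 * sinh p * (sinh p * ((sinh p)\<^sup>2 - (cosh p)\<^sup>2) + p * cosh p)"
    unfolding sinh_double cosh_double using cosh_square_eq[of p] by algebra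
  also have "\<dots> = 32 * sinh p * (p * cosh p - sinh p)"
    by (simp add: cosh_square_eq)
  also have "\<dots> / (8 * (sinh p)\<^sup>2)\<^sup>2 = D"
    using False by (simp add: D_def field_simps power2_eq_square power3_eq_cube)
  finally have "((\<lambda>p. (sinh (2 * p) - 2 * p) / (8 * (sinh p)\<^sup>2)) has_real_derivative D) (at p)" .
  then have "(alpha has_real_derivative D) (at p)"
    by (rule has_field_derivative_transform_within_open[where S = "- {0}"])
       (use False in \<open>auto simp: alpha_def\<close>)
  moreover have "D > 0"
    \<comment> \<open>Numerator and denominator of \<open>D\<close> are both odd, so the case of
      negative \<open>p\<close> follows from positivity at \<open>- p\<close>.\<close>
    using False cosh_minus_sinh_pos[of p] cosh_minus_sinh_pos[of "- p"]
    by (cases "p > 0") (auto simp: D_def zero_less_divide_iff power3_eq_cube mult_less_0_iff zero_less_mult_iff)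
  ultimately show ?thesis by blast
qed

lemma alpha_strict_mono: "strict_mono alpha"
proof (rule strict_monoI)
  fix x y :: real assume "x < y"
  then show "alpha x < alpha y"
    by (rule DERIV_pos_imp_increasing) (use alpha_has_derivative in blast)
qed

lemma alpha_continuous: "continuous_on A alpha"
  by (meson DERIV_isCont alpha_has_derivative continuous_at_imp_continuous_on)

lemma alpha_minus: "alpha (- p) = - alpha p"
  by (simp add: alpha_def field_simps)

lemma alpha_tendsto: "(alpha \<longlongrightarrow> 1 / 4) at_top"
proof -
  have "((\<lambda>p::real. (sinh (2 * p) - 2 * p) / (8 * (sinh p)\<^sup>2)) \<longlongrightarrow> 1 / 4) at_top"
    by real_asymp (simp add: power2_eq_square)
  then show ?thesis
    by (rule Lim_transform_eventually)
       (auto simp: alpha_def eventually_at_top_dense intro!: exI[of _ 0])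
qed

text \<open>Strictness comes from passing through p + 1: its value is bounded by the limit and
  already exceeds \<open>alpha p\<close>.\<close>

lemma alpha_less: "alpha p < 1 / 4"
proof -
  have "alpha (p + 1) \<le> 1 / 4"
  proof (rule tendsto_lowerbound[OF alpha_tendsto])
    show "\<forall>\<^sub>F q in at_top. alpha (p + 1) \<le> alpha q"
      using eventually_ge_at_top[of "p + 1"]
      by eventually_elim (use alpha_strict_mono in \<open>simp add: strict_mono_less_eq\<close>)
  qed simp
  then show ?thesis
    using strict_monoD[OF alpha_strict_mono, of p "p + 1"] by simp
qed

lemma alpha_surj:
  assumes "\<bar>v\<bar> < 1 / 4"
  shows "\<exists>p. alpha p = v"
proof -
  have "\<forall>\<^sub>F q in at_top. \<bar>v\<bar> < alpha q"
    by (rule order_tendstoD(1)[OF alpha_tendsto assms])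
  then obtain q where q: "\<bar>v\<bar> < alpha q" "q > 0"
    using eventually_happens[OF eventually_conj[OF _ eventually_gt_at_top[of 0]]] by force
  have "\<exists>x\<ge>- q. x \<le> q \<and> alpha x = v"
    by (rule IVT') (use q alpha_continuous in \<open>auto simp: alpha_minus\<close>)
  then show ?thesis by blast
qed

lemma alpha_range: "range alpha = {-1/4<..<1/4}"
proof (intro equalityI subsetI)
  fix v assume "v \<in> range alpha"
  then obtain p where "v = alpha p" by blast
  then show "v \<in> {-1/4<..<1/4}"
    using alpha_less[of p] alpha_less[of "- p"] by (simp add: alpha_minus)
next
  fix v :: real assume "v \<in> {-1/4<..<1/4}"
  then have "\<bar>v\<bar> < 1 / 4" by auto
  then show "v \<in> range alpha" using alpha_surj by blast
qed

lemma beta_alpha [simp]: "beta (alpha p) = p"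
  unfolding beta_def by (simp add: strict_mono_imp_inj_on[OF alpha_strict_mono])

lemma alpha_beta: "\<bar>v\<bar> < 1 / 4 \<Longrightarrow> alpha (beta v) = v"
  using alpha_surj beta_alpha by metis

lemma complexifiable_beta:
  assumes "\<bar>v\<bar> < 1 / 4"
  shows "complexifiable beta v"
proof -
  obtain p where p: "alpha p = v" using alpha_surj[OF assms] by blast
  obtain D where D: "D > 0" "(alpha has_real_derivative D) (at p)"
    using alpha_has_derivative by blast
  from complexifiable_inverse[OF complexifiable_alpha D(2) _ alpha_strict_mono alpha_continuous beta_alpha]
  show ?thesis using D(1) p by simp
qed

lemma alpha_diffeo: "real_analytic_diffeo alpha UNIV {-1/4<..<1/4}"
  unfolding real_analytic_diffeo_def
proof (intro conjI)
  have id: "analytic_germ (\<lambda>x::real. x) a" for a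
    using analytic_germ_inner[of 1 a] by simp
  show "bij_betw alpha UNIV {-1/4<..<1/4}"
    using strict_mono_imp_inj_on[OF alpha_strict_mono] alpha_range by (simp add: bij_betw_def)
  show "alpha real_analytic_on UNIV"
    using analytic_germ_compose[OF id complexifiable_alpha] by (intro real_analytic_onI) simp
  show "inv_into UNIV alpha real_analytic_on {-1/4<..<1/4}"
    unfolding beta_def[symmetric]
  proof (rule real_analytic_onI)
    fix a b :: real assume "a \<in> {-1/4<..<1/4}" "b \<in> Basis"
    moreover from this have "\<bar>a\<bar> < 1 / 4" by auto
    ultimately show "analytic_germ (\<lambda>x. beta x \<bullet> b) a"
      using analytic_germ_compose[OF id complexifiable_beta] by simp
  qed
qed simp_all

section \<open>The exponential mapping and its inverse\<close>

text \<open>One formula for all z. From t sinhc p = sqrt u one gets t, and then c = 2p/t = 2 p sinhc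
  p / sqrt u = 2 sinh p / sqrt u, with no division by p and no sign of z.\<close>

definition Exp_inv :: "real \<times> real \<times> real \<Rightarrow> real \<times> real \<times> real"
  where "Exp_inv = (\<lambda>(x, y, z).
    let u = x\<^sup>2 - y\<^sup>2; p = beta (z / u)
    in (artanh (y / x) - p, 2 * sinh p / sqrt u, sqrt u / sinhc p))"

lemma sinhc2_double: "sinhc2 (2 * p) = 2 * (sinhc p)\<^sup>2 * alpha p"
  using sinhc_pos[of p] by (simp add: alpha_eq_sinhc)

text \<open>Unlike the defining formula this one is visibly analytic across \<open>c = 0\<close>.\<close>

lemma Exp_eq_sinhc:
  assumes "t \<noteq> 0"
  shows "Exp (\<psi>, c, t) =
    (t * sinhc (c * t / 2) * cosh (\<psi> + c * t / 2),
     t * sinhc (c * t / 2) * sinh (\<psi> + c * t / 2),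
     t\<^sup>2 * sinhc2 (c * t) / 2)"
proof (cases "c = 0")
  case True
  then show ?thesis by (simp add: Exp_def sinhc_def sinhc2_def)
next
  case False
  define q where "q = c * t / 2"
  have q: "q \<noteq> 0" "c * t = 2 * q" using assms False by (auto simp: q_def)
  have ts: "t * sinhc q = 2 * sinh q / c"
    using q(1) False assms by (simp add: sinhc_def q_def)
  \<comment> \<open>Both endpoints are written symmetrically about the midpoint
    \<open>\<psi> + q\<close>, so the differences become products by the addition formulas.\<close>
  have \<psi>: "\<psi> + c * t = (\<psi> + q) + q" "sinh \<psi> = sinh ((\<psi> + q) - q)" "cosh \<psi> = cosh ((\<psi> + q) - q)"
    by (simp_all add: q(2))
  have "sinh (\<psi> + c * t) - sinh \<psi> = 2 * sinh q * cosh (\<psi> + q)"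
    "cosh (\<psi> + c * t) - cosh \<psi> = 2 * sinh q * sinh (\<psi> + q)"
    unfolding \<psi> sinh_add[of "\<psi> + q" q] sinh_diff[of "\<psi> + q" q] cosh_add[of "\<psi> + q" q] cosh_diff[of "\<psi> + q" q]
    by simp_all
  moreover have "(sinh (c * t) - c * t) / (2 * c\<^sup>2) = t\<^sup>2 * sinhc2 (c * t) / 2"
    using False assms by (simp add: sinhc2_def power_mult_distrib field_simps)
  ultimately show ?thesis
    using False ts by (simp add: Exp_def q_def[symmetric])
qed

text \<open>These are the domain conditions for the divisions, the square root, \<open>beta\<close>
  and \<open>artanh\<close> in the inverse.\<close>

lemma A_tildeD:
  assumes "(x, y, z) \<in> A_tilde"
  shows "x > 0" "x\<^sup>2 - y\<^sup>2 > 0" "\<bar>z / (x\<^sup>2 - y\<^sup>2)\<bar> < 1 / 4" "\<bar>y / x\<bar> < 1"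
proof -
  show x: "x > 0" and u: "x\<^sup>2 - y\<^sup>2 > 0"
    using assms by (auto simp: A_tilde_def)
  show "\<bar>z / (x\<^sup>2 - y\<^sup>2)\<bar> < 1 / 4"
    using assms u by (simp add: A_tilde_def abs_div_pos[symmetric] pos_divide_less_eq)
  have "\<bar>y\<bar>\<^sup>2 < x\<^sup>2"
    using u by simp
  then have "\<bar>y\<bar> < x"
    by (rule power2_less_imp_less) (rule less_imp_le[OF x])
  then show "\<bar>y / x\<bar> < 1"
    using x by simp
qed

lemma tanh_artanh_real:
  assumes "\<bar>w\<bar> < (1::real)"
  shows "tanh (artanh w) = w"
proof -
  have w: "1 + w > 0" "1 - w > 0" using assms by auto
  have "exp (- 2 * artanh w) = (1 - w) / (1 + w)"
    using w by (simp add: artanh_def exp_minus)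
  then have "tanh (artanh w) = (1 - (1 - w) / (1 + w)) / (1 + (1 - w) / (1 + w))"
    by (simp only: tanh_real_altdef)
  also have "\<dots> = w"
    using w by (simp add: field_simps)
  finally show ?thesis .
qed

text \<open>With r = t sinhc q one has x^2 - y^2 = r^2 and z = r^2 alpha q, so the defining
  inequality is the bound 1/4 on the modulus of alpha.\<close>

lemma Exp_in_A_tilde:
  assumes "t > 0"
  shows "Exp (\<psi>, c, t) \<in> A_tilde"
proof -
  define q where "q = c * t / 2"
  define r where "r = t * sinhc q"
  have r: "r > 0" using assms sinhc_pos by (simp add: r_def)
  have "4 * \<bar>t\<^sup>2 * sinhc2 (c * t) / 2\<bar> = r\<^sup>2 * (4 * \<bar>alpha q\<bar>)"
    using sinhc2_double[of q] by (simp add: q_def r_def abs_mult power_mult_distrib)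
  also have "\<dots> < r\<^sup>2 * 1"
    using r alpha_less[of q] alpha_less[of "- q"]
    by (intro mult_strict_left_mono) (auto simp: alpha_minus)
  also have "r\<^sup>2 * 1 = (r * cosh (\<psi> + q))\<^sup>2 - (r * sinh (\<psi> + q))\<^sup>2"
    using hyperbolic_pythagoras[of "\<psi> + q"] by algebra
  finally show ?thesis
    using assms r by (simp add: Exp_eq_sinhc A_tilde_def q_def r_def)
qed

lemma Exp_inv_Exp:
  assumes "t > 0"
  shows "Exp_inv (Exp (\<psi>, c, t)) = (\<psi>, c, t)"
proof -
  define q where "q = c * t / 2"
  define r where "r = t * sinhc q"
  have r: "r > 0" using assms sinhc_pos by (simp add: r_def)
  have u: "(r * cosh (\<psi> + q))\<^sup>2 - (r * sinh (\<psi> + q))\<^sup>2 = r\<^sup>2"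
    using hyperbolic_pythagoras[of "\<psi> + q"] by algebra
  have "t\<^sup>2 * sinhc2 (c * t) / 2 = r\<^sup>2 * alpha q"
    using sinhc2_double[of q] by (simp add: q_def r_def power_mult_distrib)
  then have z: "t\<^sup>2 * sinhc2 (c * t) / 2 / r\<^sup>2 = alpha q"
    using r by simp
  have "r * sinh (\<psi> + q) / (r * cosh (\<psi> + q)) = tanh (\<psi> + q)"
    using r by (simp add: tanh_def)
  then have th: "artanh (r * sinh (\<psi> + q) / (r * cosh (\<psi> + q))) = \<psi> + q"
    by (simp add: artanh_tanh_real)
  have Exp: "Exp (\<psi>, c, t) = (r * cosh (\<psi> + q), r * sinh (\<psi> + q), t\<^sup>2 * sinhc2 (c * t) / 2)"
    using assms by (simp add: Exp_eq_sinhc r_def q_def)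
  have "2 * sinh q / r = c"
    using sinhc_pos[of q] assms times_sinhc[of q] by (simp add: r_def q_def field_simps)
  moreover have "r / sinhc q = t"
    using sinhc_pos[of q] by (simp add: r_def)
  ultimately show ?thesis
    unfolding Exp Exp_inv_def Let_def prod.case u z th beta_alpha using r by simp
qed

lemma Exp_Exp_inv:
  assumes A: "(x, y, z) \<in> A_tilde"
  shows "Exp_inv (x, y, z) \<in> N" "Exp (Exp_inv (x, y, z)) = (x, y, z)"
proof -
  define u where "u = x\<^sup>2 - y\<^sup>2"
  define p where "p = beta (z / u)"
  define t where "t = sqrt u / sinhc p"
  define \<theta> where "\<theta> = artanh (y / x)"
  have x: "x > 0" and u: "u > 0" and v: "\<bar>z / u\<bar> < 1 / 4" and w: "\<bar>y / x\<bar> < 1"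
    using A_tildeD[OF A] by (auto simp: u_def)
  have t: "t > 0" using u sinhc_pos by (simp add: t_def)
  have inv: "Exp_inv (x, y, z) = (\<theta> - p, 2 * sinh p / sqrt u, t)"
    by (simp add: Exp_inv_def Let_def u_def p_def t_def \<theta>_def)
  then show "Exp_inv (x, y, z) \<in> N" using t by (simp add: N_def)
  have ct: "2 * sinh p / sqrt u * t = 2 * p"
    using u sinhc_pos[of p] by (simp add: t_def field_simps flip: times_sinhc)
  have ts: "t * sinhc p = sqrt u"
    using sinhc_pos[of p] by (simp add: t_def)
  have "sinh \<theta> / cosh \<theta> = y / x"
    using tanh_artanh_real[OF w] by (simp add: tanh_def \<theta>_def)
  then have sinh: "sinh \<theta> = cosh \<theta> * (y / x)"
    by (simp add: field_simps)
  have "(cosh \<theta>)\<^sup>2 - (cosh \<theta> * (y / x))\<^sup>2 = 1"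
    using hyperbolic_pythagoras[of \<theta>] by (simp add: sinh)
  then have "u * (cosh \<theta>)\<^sup>2 = x\<^sup>2"
    using x by (simp add: u_def field_simps)
  then have "(sqrt u * cosh \<theta>)\<^sup>2 = x\<^sup>2"
    using u by (simp add: power_mult_distrib)
  \<comment> \<open>Here x > 0 selects the correct root; cosh is positive as well.\<close>
  then have X: "sqrt u * cosh \<theta> = x"
    using x u by (simp add: power2_eq_iff_nonneg)
  then have Y: "sqrt u * sinh \<theta> = y"
    using x by (simp add: sinh flip: mult.assoc)
  have "t\<^sup>2 * sinhc2 (2 * p) / 2 = (t * sinhc p)\<^sup>2 * alpha p"
    by (simp add: sinhc2_double power_mult_distrib)
  also have "\<dots> = z"
    unfolding ts using u alpha_beta[OF v] by (simp add: p_def)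
  finally have Z: "t\<^sup>2 * sinhc2 (2 * p) / 2 = z" .
  have "2 * p / 2 = p" "\<theta> - p + p = \<theta>" by simp_all
  then show "Exp (Exp_inv (x, y, z)) = (x, y, z)"
    using Exp_eq_sinhc[of t "\<theta> - p" "2 * sinh p / sqrt u"] t
    by (simp only: inv ct Z X Y ts less_imp_neq[OF t, symmetric] simp_thms)
qed

section \<open>Bijectivity of \<open>Exp\<close> and openness of both domains\<close>

lemma bij_betw_Exp: "bij_betw Exp N A_tilde"
proof (rule bij_betwI)
  show "Exp \<in> N \<rightarrow> A_tilde"
    using Exp_in_A_tilde by (auto simp: N_def)
  show "Exp_inv \<in> A_tilde \<rightarrow> N"
  proof
    show "Exp_inv a \<in> N" if "a \<in> A_tilde" for a
      using that Exp_Exp_inv(1)[of "fst a" "fst (snd a)" "snd (snd a)"] by simp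
  qed
  show "Exp_inv (Exp a) = a" if "a \<in> N" for a
    using that Exp_inv_Exp by (auto simp: N_def)
  show "Exp (Exp_inv a) = a" if "a \<in> A_tilde" for a
    using that Exp_Exp_inv(2)[of "fst a" "fst (snd a)" "snd (snd a)"] by simp
qed

lemma inv_into_Exp:
  assumes "a \<in> A_tilde"
  shows "inv_into N Exp a = Exp_inv a"
proof (rule inv_into_f_eq)
  show "inj_on Exp N" by (rule bij_betw_imp_inj_on[OF bij_betw_Exp])
  show "Exp_inv a \<in> N" "Exp (Exp_inv a) = a"
    using assms Exp_Exp_inv[of "fst a" "fst (snd a)" "snd (snd a)"] by simp_all
qed

lemma open_N: "open N"
proof -
  have N: "N = {a. 0 < snd (snd a)}" by (auto simp: N_def)
  show ?thesis unfolding N by (intro open_Collect_less continuous_intros)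
qed

lemma open_A_tilde: "open A_tilde"
proof -
  have A: "A_tilde = {a. - (fst a)\<^sup>2 + (fst (snd a))\<^sup>2 + 4 * \<bar>snd (snd a)\<bar> < 0} \<inter> {a. 0 < fst a}"
    by (auto simp: A_tilde_def)
  show ?thesis unfolding A by (intro open_Int open_Collect_less continuous_intros)
qed

section \<open>Analyticity of \<open>Exp\<close> and of its inverse\<close>

lemma analytic_germ_coordinates:
  fixes a :: "real \<times> real \<times> real"
  shows "analytic_germ fst a" "analytic_germ (\<lambda>x. fst (snd x)) a" "analytic_germ (\<lambda>x. snd (snd x)) a"
  using analytic_germ_inner[of "(1, 0, 0)" a] analytic_germ_inner[of "(0, 1, 0)" a]
    analytic_germ_inner[of "(0, 0, 1)" a]
  by (simp_all add: inner_prod_def)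

text \<open>Pairing with an arbitrary triple \<open>b\<close> covers every basis vector at once.
  Openness of \<open>S\<close> turns equality on \<open>S\<close> into equality near each
  point.\<close>

lemma real_analytic_on_triple:
  fixes f :: "'a::euclidean_space \<Rightarrow> real \<times> real \<times> real"
  assumes "open S" and "\<And>x. x \<in> S \<Longrightarrow> f x = (f1 x, f2 x, f3 x)"
    and "\<And>a. a \<in> S \<Longrightarrow> analytic_germ f1 a" "\<And>a. a \<in> S \<Longrightarrow> analytic_germ f2 a"
      "\<And>a. a \<in> S \<Longrightarrow> analytic_germ f3 a"
  shows "f real_analytic_on S"
proof (rule real_analytic_onI)
  fix a and b :: "real \<times> real \<times> real" assume a: "a \<in> S"
  have "analytic_germ (\<lambda>x. f1 x * fst b + (f2 x * fst (snd b) + f3 x * snd (snd b))) a"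
    using assms(3-5)[OF a] by (intro analytic_germ_add analytic_germ_mult analytic_germ_const)
  then show "analytic_germ (\<lambda>x. f x \<bullet> b) a"
  proof (rule analytic_germ_cong)
    show "\<forall>\<^sub>F x in nhds a. f x \<bullet> b = f1 x * fst b + (f2 x * fst (snd b) + f3 x * snd (snd b))"
      using eventually_nhds_in_open[OF assms(1) a]
      by eventually_elim (simp add: assms(2) inner_prod_def)
  qed
qed

lemma analytic_germ_divide:
  assumes "analytic_germ f a" "analytic_germ g a" "g a \<noteq> 0"
  shows "analytic_germ (\<lambda>x. f x / g x) a"
  unfolding divide_inverse
  by (intro analytic_germ_mult analytic_germ_compose[where g = inverse] complexifiable_inverse_fun assms)

lemma Exp_real_analytic: "Exp real_analytic_on N"
proof (rule real_analytic_on_triple[OF open_N])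
  fix a :: "real \<times> real \<times> real" assume "a \<in> N"
  define q where "q = (\<lambda>x :: real \<times> real \<times> real. fst (snd x) * snd (snd x) / 2)"
  have q: "analytic_germ q a"
    unfolding q_def by (intro analytic_germ_divide analytic_germ_mult analytic_germ_const
        analytic_germ_coordinates) simp
  have Sq: "analytic_germ (\<lambda>x. sinhc (q x)) a"
    by (rule analytic_germ_compose[OF q complexifiable_sinhc])
  have s: "analytic_germ (\<lambda>x. fst x + q x) a"
    by (intro analytic_germ_add analytic_germ_coordinates q)
  show "analytic_germ (\<lambda>x. snd (snd x) * sinhc (fst (snd x) * snd (snd x) / 2) *
      cosh (fst x + fst (snd x) * snd (snd x) / 2)) a"
    using Sq analytic_germ_compose[OF s complexifiable_cosh] unfolding q_def
    by (intro analytic_germ_mult analytic_germ_coordinates)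
  show "analytic_germ (\<lambda>x. snd (snd x) * sinhc (fst (snd x) * snd (snd x) / 2) *
      sinh (fst x + fst (snd x) * snd (snd x) / 2)) a"
    using Sq analytic_germ_compose[OF s complexifiable_sinh] unfolding q_def
    by (intro analytic_germ_mult analytic_germ_coordinates)
  show "analytic_germ (\<lambda>x. (snd (snd x))\<^sup>2 * sinhc2 (fst (snd x) * snd (snd x)) / 2) a"
    by (intro analytic_germ_divide analytic_germ_mult analytic_germ_power analytic_germ_const
        analytic_germ_coordinates analytic_germ_compose[where g = sinhc2] complexifiable_sinhc2) simp
qed (auto simp: N_def Exp_eq_sinhc)

lemma inv_into_Exp_real_analytic: "inv_into N Exp real_analytic_on A_tilde"
proof (rule real_analytic_on_triple[OF open_A_tilde])
  define u where "u = (\<lambda>x :: real \<times> real \<times> real. (fst x)\<^sup>2 - (fst (snd x))\<^sup>2)"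
  define p where "p = (\<lambda>x. beta (snd (snd x) / u x))"
  fix a assume A: "a \<in> A_tilde"
  obtain x y z where a: "a = (x, y, z)" by (cases a)
  have x: "fst a > 0" and u0: "u a > 0" and v: "\<bar>snd (snd a) / u a\<bar> < 1 / 4"
    and w: "\<bar>fst (snd a) / fst a\<bar> < 1"
    using A_tildeD[of x y z] A by (auto simp: a u_def)
  have u: "analytic_germ u a"
    unfolding u_def by (intro analytic_germ_diff analytic_germ_power analytic_germ_coordinates)
  have "analytic_germ (\<lambda>x. snd (snd x) / u x) a"
    using u0 by (intro analytic_germ_divide analytic_germ_coordinates u) simp
  from analytic_germ_compose[OF this complexifiable_beta[OF v]]
  have p: "analytic_germ p a" by (simp add: p_def)
  have su: "analytic_germ (\<lambda>x. sqrt (u x)) a"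
    by (rule analytic_germ_compose[OF u complexifiable_sqrt[OF u0]])
  have "analytic_germ (\<lambda>x. fst (snd x) / fst x) a"
    using x by (intro analytic_germ_divide analytic_germ_coordinates) simp
  from analytic_germ_compose[OF this complexifiable_artanh[OF w]]
  show "analytic_germ (\<lambda>x. artanh (fst (snd x) / fst x) - p x) a"
    by (intro analytic_germ_diff p)
  show "analytic_germ (\<lambda>x. 2 * sinh (p x) / sqrt (u x)) a"
    using u0 by (intro analytic_germ_divide analytic_germ_mult analytic_germ_const su
        analytic_germ_compose[OF p complexifiable_sinh]) simp
  show "analytic_germ (\<lambda>x. sqrt (u x) / sinhc (p x)) a"
    using sinhc_pos[of "p a"] by (intro analytic_germ_divide su
        analytic_germ_compose[OF p complexifiable_sinhc]) simp
  show "inv_into N Exp a = (artanh (fst (snd a) / fst a) - p a, 2 * sinh (p a) / sqrt (u a), sqrt (u a) / sinhc (p a))"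
    unfolding inv_into_Exp[OF A] by (simp add: a Exp_inv_def Let_def u_def p_def)
qed

section \<open>The inverse in the stated closed form\<close>

lemma sgn_alpha: "sgn (alpha p) = sgn p"
proof -
  have "alpha 0 = 0" by (simp add: alpha_def)
  then show ?thesis
    using strict_monoD[OF alpha_strict_mono, of 0 p] strict_monoD[OF alpha_strict_mono, of p 0]
    by (cases p "0::real" rule: linorder_cases) auto
qed

text \<open>Since alpha p = z/u with u = x^2 - y^2, the radicand equals (2 sinh p)^2 / u. Its root
  loses the sign of sinh p, and \<open>sgn z\<close> restores it because z, alpha p and p have the
  same sign.\<close>

lemma Exp_inv_formula:
  assumes A: "(x, y, z) \<in> A_tilde" and z: "z \<noteq> 0"
  defines "p \<equiv> beta (z / (x\<^sup>2 - y\<^sup>2))"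
  defines "c \<equiv> sgn z * sqrt ((sinh (2 * p) - 2 * p) / (2 * z))"
  shows "Exp_inv (x, y, z) = (artanh (y / x) - p, c, 2 * p / c)"
proof -
  define u where "u = x\<^sup>2 - y\<^sup>2"
  have u: "u > 0" and v: "\<bar>z / u\<bar> < 1 / 4"
    using A_tildeD[OF A] by (auto simp: u_def)
  have ap: "alpha p = z / u"
    using alpha_beta[OF v] by (simp add: p_def u_def)
  then have p0: "p \<noteq> 0" using z u by (auto simp: alpha_def)
  have sgn: "sgn z = sgn p"
    using sgn_alpha[of p] u by (simp add: ap sgn_divide)
  have "(sinh (2 * p) - 2 * p) / (2 * z) = (2 * sinh p)\<^sup>2 / u"
    using ap p0 z u by (simp add: alpha_def field_simps power2_eq_square)
  then have "c = sgn p * (\<bar>2 * sinh p\<bar> / sqrt u)"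
    unfolding c_def sgn by (simp only: real_sqrt_divide real_sqrt_abs)
  also have "\<dots> = 2 * sinh p / sqrt u"
    using p0 by (cases "p > 0") (auto simp: abs_if)
  finally have c: "c = 2 * sinh p / sqrt u" .
  have "2 * p / c = sqrt u / sinhc p"
    using p0 by (simp add: c sinhc_def)
  then show ?thesis
    using c by (simp add: Exp_inv_def Let_def p_def u_def)
qed

lemma Exp_inv_formula_zero:
  assumes "(x, y, 0) \<in> A_tilde"
  shows "Exp_inv (x, y, 0) = (artanh (y / x), 0, sqrt (x\<^sup>2 - y\<^sup>2))"
proof -
  have "beta 0 = 0"
    using beta_alpha[of 0] by (simp add: alpha_def)
  then show ?thesis by (simp add: Exp_inv_def sinhc_def)
qed

theorem theorem3:
  "real_analytic_diffeo alpha UNIV {-1/4<..<1/4} \<and>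
   real_analytic_diffeo Exp N A_tilde \<and>
   (\<forall>x y z. (x, y, z) \<in> A_tilde \<longrightarrow>
      (z = 0 \<longrightarrow>
        inv_into N Exp (x, y, z) = (artanh (y / x), 0, sqrt (x\<^sup>2 - y\<^sup>2))) \<and>
      (z \<noteq> 0 \<longrightarrow>
        (let p = beta (z / (x\<^sup>2 - y\<^sup>2));
             c = sgn z * sqrt ((sinh (2 * p) - 2 * p) / (2 * z))
         in inv_into N Exp (x, y, z) = (artanh (y / x) - p, c, 2 * p / c))))"
proof (intro conjI allI impI)
  show "real_analytic_diffeo alpha UNIV {-1/4<..<1/4}"
    by (rule alpha_diffeo)
  show "real_analytic_diffeo Exp N A_tilde"
    unfolding real_analytic_diffeo_def
    using open_N open_A_tilde bij_betw_Exp Exp_real_analytic inv_into_Exp_real_analytic by blast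
next
  fix x y z :: real assume A: "(x, y, z) \<in> A_tilde"
  show "inv_into N Exp (x, y, z) = (artanh (y / x), 0, sqrt (x\<^sup>2 - y\<^sup>2))" if "z = 0"
    using A inv_into_Exp[OF A] Exp_inv_formula_zero that by simp
  show "let p = beta (z / (x\<^sup>2 - y\<^sup>2)); c = sgn z * sqrt ((sinh (2 * p) - 2 * p) / (2 * z))
      in inv_into N Exp (x, y, z) = (artanh (y / x) - p, c, 2 * p / c)" if "z \<noteq> 0"
    unfolding Let_def inv_into_Exp[OF A] by (rule Exp_inv_formula[OF A that])
qed

end
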